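(* Both of the following problems are decidable for one-counter automata with parameterised tests: (1) the reachability problem: given a one-counter automaton with parameterised tests $\mathcal{C}=(V,E,X,\lambda,\tau)$ and configurations $(v,c)$, $(v',c')$, decide whether there exist values in $\mathbb{N}$ for the parameters in $X$ such that, after substituting these values, there is a valid computation from $(v,c)$ to $(v',c')$; (2) the generalised repeated control-state reachability problem: given such a $\mathcal{C}$, sets of final states $F_1,\ldots,F_n\subseteq V$ and an initial configuration $(v,c)$, decide whether there exist values in $\mathbb{N}$ for the parameters such that, after substituting these values, there is a valid infinite computation starting from $(v,c)$ that visits at least one state of each $F_i$ infinitely often.
   Context: A one-counter automaton with parameterised tests is a tuple $\mathcal{C}=(V,E,X,\lambda,\tau)$ where $V$ is a finite set of states, $E\subseteq V\times V$ is a finite set of edges, $X$ is a finite set of parameters ranging over nonnegative integers, $\lambda$ labels each edge with an operation from $\{\mathrm{add}(a): a\in\mathbb{Z}\}\cup\{\mathrm{eq}(a): a\in\mathbb{N}\}\cup\{\mathrm{eq}(x): x\in X\}$, and $\tau$ maps each state $v$ to a finite set $\tau(v)\subseteq \mathbb{N}\cup X$ of invalid counter values at $v$. Once the parameters are assigned values in $\mathbb{N}$, each label $\mathrm{eq}(x)$ becomes $\mathrm{eq}(a)$ and $\tau(v)$ becomes a finite subset of $\mathbb{N}$. For an edge $e$ with label $\mathrm{add}(a)$ its weight is $a$; for a label $\mathrm{eq}(\cdot)$ its weight is $0$. A configuration is a pair $(v,c)\in V\times\mathbb{Z}$. There is a transition $(v,c)\to(v',c')$ via edge $e=(v,v')$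 if $c'-c$ equals the weight of $e$. The transition is valid if $c\ge 0$, $c'\ge 0$, $c\notin\tau(v)$, and, if $\lambda(e)=\mathrm{eq}(a)$, also $c=a$. A computation is a finite or infinite sequence of transitions $(v_1,c_1)\to(v_2,c_2)\to\cdots$; it is valid if all its transitions are valid (and, for a computation with no transitions, if its single configuration has nonnegative counter value). *)

theory Defs
  imports Complex_Main "HOL-Library.Nat_Bijection" "HOL-Library.Infinite_Set"
begin

section \<open>Decidability\<close>

text \<open>
  The libraries used here have no model of computation, so the partial recursive functions
  (Kleene) are introduced as programs with a big-step semantics:
  \<open>computes f xs y\<close> says that program \<open>f\<close> halts on the
  argument tuple \<open>xs\<close> with result \<open>y\<close>. For \<open>Mu f\<close>, all values of \<open>f\<close> below
  the zero that is found must be defined, as usual.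
\<close>

datatype recf =
    Zero
  | Succ
  | Proj nat
  | Comp recf "recf list"
  | PrimRec recf recf
  | Mu recf

inductive computes :: "recf \<Rightarrow> nat list \<Rightarrow> nat \<Rightarrow> bool" where
  Zero: "computes Zero xs 0"
| Succ: "computes Succ [x] (Suc x)"
| Proj: "i < length xs \<Longrightarrow> computes (Proj i) xs (xs ! i)"
| Comp: "list_all2 (\<lambda>g y. computes g xs y) gs ys \<Longrightarrow> computes f ys z
    \<Longrightarrow> computes (Comp f gs) xs z"
| PrimRec_0: "computes f xs y \<Longrightarrow> computes (PrimRec f g) (0 # xs) y"
| PrimRec_Suc: "computes (PrimRec f g) (n # xs) y \<Longrightarrow> computes g (y # n # xs) z
    \<Longrightarrow> computes (PrimRec f g) (Suc n # xs) z"
| Mu: "computes f (n # xs) 0 \<Longrightarrow> (\<forall>m<n. \<exists>k. computes f (m # xs) (Suc k))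
    \<Longrightarrow> computes (Mu f) xs n"

lemma computes_deterministic:
  assumes "computes f xs y" and "computes f xs z"
  shows "y = z"
  using assms
proof (induction arbitrary: z rule: computes.induct)
  case (Zero xs)
  then show ?case by (auto elim: computes.cases)
next
  case (Succ x)
  then show ?case by (auto elim: computes.cases)
next
  case (Proj i xs)
  then show ?case by (auto elim: computes.cases)
next
  case (Comp xs gs ys f w)
  from Comp.prems obtain ys' where ys': "list_all2 (\<lambda>g y. computes g xs y) gs ys'"
    and z: "computes f ys' z"
    by (auto elim: computes.cases)
  have "ys = ys'"
    using Comp.IH(1) ys' by (auto simp: list_all2_conv_all_nth intro!: nth_equalityI)
  then show ?case using Comp.IH(2) z by blast
next
  case (PrimRec_0 f xs y g)
  from PrimRec_0.prems have "computes f xs z" by (auto elim: computes.cases)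
  then show ?case using PrimRec_0.IH by blast
next
  case (PrimRec_Suc f g n xs y w)
  from PrimRec_Suc.prems obtain y' where "computes (PrimRec f g) (n # xs) y'"
    and "computes g (y' # n # xs) z"
    by (auto elim: computes.cases)
  then show ?case using PrimRec_Suc.IH by blast
next
  case (Mu f n xs)
  from Mu.prems have 1: "computes f (z # xs) 0"
    and 2: "\<forall>m<z. \<exists>k. computes f (m # xs) (Suc k)"
    by (auto elim: computes.cases)
  have "\<not> z < n" using Mu.IH(2) 1 by fastforce
  moreover have "\<not> n < z" using Mu.IH(1) 2 by fastforce
  ultimately show ?case by simp
qed

text \<open>
  A decision problem is given by its set of instances, a coding of instances by natural numbers and
  the property to be decided. It is decidable if one program halts on the code of every
  instance and answers correctly.
\<close>

definition decidable_problem :: "'i set \<Rightarrow> ('i \<Rightarrow> nat) \<Rightarrow> ('i \<Rightarrow> bool) \<Rightarrow> bool" where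
  "decidable_problem I code P \<longleftrightarrow>
     (\<exists>f. \<forall>i\<in>I. computes f [code i] (if P i then 1 else 0))"


section \<open>One-counter automata with parameterised tests\<close>

text \<open>The disjoint union of the natural numbers and the parameters.\<close>

datatype 'x val = Const nat | Par 'x

datatype 'x operation = Add int | Eq "'x val"

record ('v, 'x) oca =
  states :: "'v set"
  edges :: "('v \<times> 'v) set"
  params :: "'x set"
  lab :: "'v \<times> 'v \<Rightarrow> 'x operation"
  tests :: "'v \<Rightarrow> 'x val set"

definition vals :: "'x set \<Rightarrow> 'x val set" where
  "vals X = range Const \<union> Par ` X"

text \<open>Labels outside \<open>edges\<close> and tests outside \<open>states\<close> are irrelevant and left unconstrained.\<close>

definition wf_oca :: "('v, 'x) oca \<Rightarrow> bool" where
  "wf_oca C \<longleftrightarrow>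
     finite (states C) \<and>
     edges C \<subseteq> states C \<times> states C \<and>
     finite (params C) \<and>
     (\<forall>e\<in>edges C. lab C e \<in> range Add \<union> Eq ` vals (params C)) \<and>
     (\<forall>v\<in>states C. finite (tests C v) \<and> tests C v \<subseteq> vals (params C))"

fun subst_val :: "('x \<Rightarrow> nat) \<Rightarrow> 'x val \<Rightarrow> 'x val" where
  "subst_val \<nu> (Const a) = Const a"
| "subst_val \<nu> (Par x) = Const (\<nu> x)"

fun subst_op :: "('x \<Rightarrow> nat) \<Rightarrow> 'x operation \<Rightarrow> 'x operation" where
  "subst_op \<nu> (Add a) = Add a"
| "subst_op \<nu> (Eq t) = Eq (subst_val \<nu> t)"

definition subst_oca :: "('x \<Rightarrow> nat) \<Rightarrow> ('v, 'x) oca \<Rightarrow> ('v, 'x) oca" where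
  "subst_oca \<nu> C = C\<lparr> params := {},
                       lab := \<lambda>e. subst_op \<nu> (lab C e),
                       tests := \<lambda>v. subst_val \<nu> ` tests C v \<rparr>"

type_synonym 'v config = "'v \<times> int"

definition configs :: "('v, 'x) oca \<Rightarrow> 'v config set" where
  "configs C = states C \<times> UNIV"

fun weight :: "'x operation \<Rightarrow> int" where
  "weight (Add a) = a"
| "weight (Eq t) = 0"

definition transition :: "('v, 'x) oca \<Rightarrow> 'v config \<Rightarrow> 'v config \<Rightarrow> bool" where
  "transition C p q \<longleftrightarrow>
     (fst p, fst q) \<in> edges C \<and> snd q - snd p = weight (lab C (fst p, fst q))"

text \<open>Validity is used only for automata whose parameters have been substituted.\<close>

definition valid_transition :: "('v, 'x) oca \<Rightarrow> 'v config \<Rightarrow> 'v config \<Rightarrow> bool" where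
  "valid_transition C p q \<longleftrightarrow>
     transition C p q \<and> 0 \<le> snd p \<and> 0 \<le> snd q \<and>
     snd p \<notin> int ` {a. Const a \<in> tests C (fst p)} \<and>
     (\<forall>a. lab C (fst p, fst q) = Eq (Const a) \<longrightarrow> snd p = int a)"

text \<open>
  An edge is determined by its endpoints, so a computation is determined by its configurations.
  A finite computation is the nonempty list of these.
\<close>

definition valid_fin_computation :: "('v, 'x) oca \<Rightarrow> 'v config list \<Rightarrow> bool" where
  "valid_fin_computation C cs \<longleftrightarrow>
     cs \<noteq> [] \<and> set cs \<subseteq> configs C \<and>
     (\<forall>i. Suc i < length cs \<longrightarrow> valid_transition C (cs ! i) (cs ! Suc i)) \<and>
     (length cs = 1 \<longrightarrow> 0 \<le> snd (hd cs))"

definition valid_inf_computation :: "('v, 'x) oca \<Rightarrow> (nat \<Rightarrow> 'v config) \<Rightarrow> bool" where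
  "valid_inf_computation C \<rho> \<longleftrightarrow>
     range \<rho> \<subseteq> configs C \<and> (\<forall>i. valid_transition C (\<rho> i) (\<rho> (Suc i)))"

definition reachable :: "('v, 'x) oca \<Rightarrow> 'v config \<Rightarrow> 'v config \<Rightarrow> bool" where
  "reachable C p q \<longleftrightarrow> (\<exists>cs. valid_fin_computation C cs \<and> hd cs = p \<and> last cs = q)"

definition rep_reachable :: "('v, 'x) oca \<Rightarrow> 'v set list \<Rightarrow> 'v config \<Rightarrow> bool" where
  "rep_reachable C Fs p \<longleftrightarrow>
     (\<exists>\<rho>. valid_inf_computation C \<rho> \<and> \<rho> 0 = p \<and>
          (\<forall>F\<in>set Fs. \<exists>v\<in>F. \<exists>\<^sub>\<infinity>i. fst (\<rho> i) = v))"


section \<open>The decision problems\<close>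

text \<open>
  For instances to be finite objects, states and parameters are named by natural numbers. All
  codes are built from the bijections of the library; \<open>set_encode\<close> is applied to finite sets only.
\<close>

fun val_code :: "nat val \<Rightarrow> nat" where
  "val_code (Const a) = sum_encode (Inl a)"
| "val_code (Par x) = sum_encode (Inr x)"

fun op_code :: "nat operation \<Rightarrow> nat" where
  "op_code (Add a) = sum_encode (Inl (int_encode a))"
| "op_code (Eq t) = sum_encode (Inr (val_code t))"

definition oca_code :: "(nat, nat) oca \<Rightarrow> nat" where
  "oca_code C = list_encode
     [set_encode (states C),
      set_encode (params C),
      set_encode ((\<lambda>e. prod_encode (prod_encode e, op_code (lab C e))) ` edges C),
      set_encode ((\<lambda>v. prod_encode (v, set_encode (val_code ` tests C v))) ` states C)]"

definition config_code :: "nat config \<Rightarrow> nat" where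
  "config_code p = prod_encode (fst p, int_encode (snd p))"

type_synonym reach_instance = "(nat, nat) oca \<times> nat config \<times> nat config"

definition reach_instances :: "reach_instance set" where
  "reach_instances = {(C, p, q). wf_oca C \<and> p \<in> configs C \<and> q \<in> configs C}"

definition reach_code :: "reach_instance \<Rightarrow> nat" where
  "reach_code = (\<lambda>(C, p, q). list_encode [oca_code C, config_code p, config_code q])"

definition reach_problem :: "reach_instance \<Rightarrow> bool" where
  "reach_problem = (\<lambda>(C, p, q). \<exists>\<nu>. reachable (subst_oca \<nu> C) p q)"

type_synonym rep_reach_instance = "(nat, nat) oca \<times> nat set list \<times> nat config"

definition rep_reach_instances :: "rep_reach_instance set" where
  "rep_reach_instances =
     {(C, Fs, p). wf_oca C \<and> (\<forall>F\<in>set Fs. F \<subseteq> states C) \<and> p \<in> configs C}"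

definition rep_reach_code :: "rep_reach_instance \<Rightarrow> nat" where
  "rep_reach_code = (\<lambda>(C, Fs, p).
     list_encode [oca_code C, list_encode (map set_encode Fs), config_code p])"

definition rep_reach_problem :: "rep_reach_instance \<Rightarrow> bool" where
  "rep_reach_problem = (\<lambda>(C, Fs, p). \<exists>\<nu>. rep_reachable (subst_oca \<nu> C) Fs p)"

end

theory Submission
  imports Defs
begin

text \<open>
  Both problems become reachability problems for runs on the number line, where the values of the
  constants and parameters are marked positions. Fix a run whose counter stays below \<open>M\<close>. Cut the
  line at \<open>h\<close>, above the constants and the counter values of the two end points, and record which
  excursions above \<open>h\<close> are possible and which parameters lie below \<open>h\<close>. If two cuts \<open>h < h'\<close> carry the
  same record, the segment between them contains no marked position and can be deleted: every
  excursion above \<open>h\<close> is replaced by a shifted excursion above \<open>h'\<close>. There are finitely many records,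
  so minimal parameter values and the minimal \<open>M\<close> are bounded by a computable function of the instance.
  Reachability below a bound is decided by quantifying over all closed sets of configurations.

  An infinite run contains a loop through all \<open>F\<^sub>i\<close> that either returns to the same configuration or
  stays above all tests and does not lower the counter. One additional parameter remembers the
  counter value at the start of the loop, so the existence of such a loop is again a reachability problem.
\<close>

section \<open>Computable functions\<close>

definition computable_n :: "nat \<Rightarrow> (nat list \<Rightarrow> nat) \<Rightarrow> bool" where
  "computable_n k F \<longleftrightarrow> (\<exists>r. \<forall>xs. length xs = k \<longrightarrow> computes r xs (F xs))"

lemma computable_n_cong:
  "(\<And>xs. length xs = k \<Longrightarrow> F xs = G xs) \<Longrightarrow> computable_n k F \<longleftrightarrow> computable_n k G"
  by (auto simp: computable_n_def)

lemma computable_n_zero: "computable_n k (\<lambda>xs. 0)"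
  unfolding computable_n_def using computes.Zero by blast

lemma computable_n_nth: "i < k \<Longrightarrow> computable_n k (\<lambda>xs. xs ! i)"
  unfolding computable_n_def using computes.Proj by blast

lemma computable_n_comp:
  assumes F: "computable_n (length Gs) F" and Gs: "\<forall>G\<in>set Gs. computable_n k G"
  shows "computable_n k (\<lambda>xs. F (map (\<lambda>G. G xs) Gs))"
proof -
  obtain f where f: "\<And>xs. length xs = length Gs \<Longrightarrow> computes f xs (F xs)"
    using F unfolding computable_n_def by blast
  obtain g where g: "\<And>G xs. G \<in> set Gs \<Longrightarrow> length xs = k \<Longrightarrow> computes (g G) xs (G xs)"
    using Gs unfolding computable_n_def by metis
  have "computes (Comp f (map g Gs)) xs (F (map (\<lambda>G. G xs) Gs))" if "length xs = k" for xs
  proof (rule computes.Comp)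
    show "list_all2 (\<lambda>g y. computes g xs y) (map g Gs) (map (\<lambda>G. G xs) Gs)"
      by (auto simp: list_all2_conv_all_nth g that)
    show "computes f (map (\<lambda>G. G xs) Gs) (F (map (\<lambda>G. G xs) Gs))"
      by (simp add: f)
  qed
  then show ?thesis unfolding computable_n_def by blast
qed

lemma computable_n_Suc:
  assumes "computable_n k F" shows "computable_n k (\<lambda>xs. Suc (F xs))"
proof -
  have "computable_n (length [F]) (\<lambda>xs. Suc (hd xs))"
    unfolding computable_n_def
    by (rule exI[of _ Succ]) (auto simp: length_Suc_conv intro: computes.Succ)
  from computable_n_comp[OF this] assms show ?thesis by simp
qed

text \<open>\<open>PrimRec\<close> hands its step function the previous value, then the counter,
  then the parameters; the second premise reads them off in this order. The recursion argument
  \<open>H\<close> is substituted afterwards, by composition with projections.\<close>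

lemma computable_n_rec:
  assumes F: "computable_n k F"
    and G: "computable_n (Suc (Suc k)) (\<lambda>ys. G (tl (tl ys)) (ys ! 1) (ys ! 0))"
    and H: "computable_n k H"
  shows "computable_n k (\<lambda>xs. rec_nat (F xs) (G xs) (H xs))"
proof -
  obtain f where f: "\<And>xs. length xs = k \<Longrightarrow> computes f xs (F xs)"
    using F unfolding computable_n_def by blast
  obtain g where g: "\<And>ys. length ys = Suc (Suc k) \<Longrightarrow> computes g ys (G (tl (tl ys)) (ys ! 1) (ys ! 0))"
    using G unfolding computable_n_def by blast
  have rec: "computes (PrimRec f g) (n # xs) (rec_nat (F xs) (G xs) n)" if "length xs = k" for n xs
  proof (induction n)
    case 0
    show ?case using computes.PrimRec_0[OF f[OF that]] by simp
  next
    case (Suc n)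
    have "computes g (rec_nat (F xs) (G xs) n # n # xs) (G xs n (rec_nat (F xs) (G xs) n))"
      using g[of "rec_nat (F xs) (G xs) n # n # xs"] that by simp
    from computes.PrimRec_Suc[OF Suc this] show ?case by simp
  qed
  let ?R = "\<lambda>ys. rec_nat (F (tl ys)) (G (tl ys)) (hd ys)"
  let ?Hs = "H # map (\<lambda>i xs. xs ! i) [0..<k]"
  have "computable_n (length ?Hs) ?R"
    unfolding computable_n_def
  proof (intro exI allI impI)
    fix xs :: "nat list" assume "length xs = length ?Hs"
    then have "xs = hd xs # tl xs" "length (tl xs) = k" by (cases xs; simp)+
    with rec show "computes (PrimRec f g) xs (?R xs)" by metis
  qed
  moreover have "\<forall>G\<in>set ?Hs. computable_n k G"
    using H by (auto intro: computable_n_nth)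
  ultimately have *: "computable_n k (\<lambda>xs. ?R (map (\<lambda>G. G xs) ?Hs))"
    by (rule computable_n_comp)
  have "map (\<lambda>i. xs ! i) [0..<k] = xs" if "length xs = k" for xs :: "nat list"
    using that map_nth by blast
  then have "computable_n k (\<lambda>xs. ?R (map (\<lambda>G. G xs) ?Hs)) \<longleftrightarrow> ?thesis"
    by (intro computable_n_cong) (simp only: list.map map_map comp_def list.sel)
  with * show ?thesis by blast
qed

text \<open>Lets a function of the parameters serve as the step of a recursion, whose argument tuple
  is longer by two entries.\<close>

lemma computable_n_drop2:
  assumes "computable_n k F" shows "computable_n (Suc (Suc k)) (\<lambda>ys. F (tl (tl ys)))"
proof -
  let ?Gs = "map (\<lambda>i ys. ys ! Suc (Suc i)) [0..<k]"
  have "computable_n (Suc (Suc k)) (\<lambda>ys. F (map (\<lambda>G. G ys) ?Gs))"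
    by (rule computable_n_comp) (use assms in \<open>auto intro!: computable_n_nth\<close>)
  moreover have "map (\<lambda>G. G ys) ?Gs = tl (tl ys)" if "length ys = Suc (Suc k)" for ys :: "nat list"
    by (rule nth_equalityI) (use that in \<open>simp_all add: nth_tl\<close>)
  then have "computable_n (Suc (Suc k)) (\<lambda>ys. F (map (\<lambda>G. G ys) ?Gs)) \<longleftrightarrow> ?thesis"
    by (intro computable_n_cong) simp
  ultimately show ?thesis by blast
qed

lemma computable_n_add:
  assumes "computable_n k F" "computable_n k G" shows "computable_n k (\<lambda>xs. F xs + G xs)"
proof -
  have "rec_nat a (\<lambda>_ y. Suc y) b = a + b" for a b :: nat by (induction b) auto
  moreover have "computable_n k (\<lambda>xs. rec_nat (F xs) (\<lambda>_ y. Suc y) (G xs))"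
    by (rule computable_n_rec) (use assms in \<open>auto intro!: computable_n_Suc computable_n_nth\<close>)
  ultimately show ?thesis by simp
qed

lemma computable_n_diff:
  assumes "computable_n k F" "computable_n k G" shows "computable_n k (\<lambda>xs. F xs - G xs)"
proof -
  have pred: "computable_n j (\<lambda>xs. H xs - 1)" if "computable_n j H" for j H
  proof -
    have "rec_nat 0 (\<lambda>n y. n) a = a - 1" for a :: nat by (cases a) auto
    moreover have "computable_n j (\<lambda>xs. rec_nat 0 (\<lambda>n y. n) (H xs))"
      by (rule computable_n_rec) (use that in \<open>auto intro!: computable_n_zero computable_n_nth[of 1, simplified]\<close>)
    ultimately show ?thesis by simp
  qed
  have "rec_nat a (\<lambda>_ y. y - 1) b = a - b" for a b :: nat by (induction b) auto
  moreover have "computable_n k (\<lambda>xs. rec_nat (F xs) (\<lambda>_ y. y - 1) (G xs))"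
    by (rule computable_n_rec) (use assms pred[OF computable_n_nth[of 0]] in auto)
  ultimately show ?thesis by simp
qed

section \<open>Cantor pairing and its inverse\<close>

lemma computable_n_triangle:
  assumes "computable_n k F" shows "computable_n k (\<lambda>xs. triangle (F xs))"
proof -
  have "rec_nat 0 (\<lambda>n y. y + Suc n) a = triangle a" for a :: nat by (induction a) auto
  moreover have "computable_n k (\<lambda>xs. rec_nat 0 (\<lambda>n y. y + Suc n) (F xs))"
    by (rule computable_n_rec)
      (use assms in \<open>auto intro!: computable_n_zero computable_n_Suc computable_n_add computable_n_nth simp del: One_nat_def add_Suc_right\<close>)
  ultimately show ?thesis by simp
qed

definition pfst :: "nat \<Rightarrow> nat" where "pfst z = fst (prod_decode z)"
definition psnd :: "nat \<Rightarrow> nat" where "psnd z = snd (prod_decode z)"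
definition pair :: "nat \<Rightarrow> nat \<Rightarrow> nat" where "pair a b = prod_encode (a, b)"

lemma pfst_pair [simp]: "pfst (pair a b) = a" by (simp add: pfst_def pair_def)
lemma psnd_pair [simp]: "psnd (pair a b) = b" by (simp add: psnd_def pair_def)
lemma pair_eq [simp]: "pair a b = pair c d \<longleftrightarrow> a = c \<and> b = d" by (simp add: pair_def)
lemma pair_pfst_psnd [simp]: "pair (pfst z) (psnd z) = z" by (simp add: pfst_def psnd_def pair_def)

text \<open>The largest \<open>r\<close> with \<open>triangle r\<close> \<le> \<open>n\<close>. By
  truncated subtraction the comparison is a test for zero, so that
  \<open>computable_n_if_zero\<close> applies.\<close>

fun triangle_root :: "nat \<Rightarrow> nat" where
  "triangle_root 0 = 0"
| "triangle_root (Suc n) =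
     (if triangle (Suc (triangle_root n)) - Suc n = 0 then Suc (triangle_root n) else triangle_root n)"

lemma triangle_root_bounds: "triangle (triangle_root n) \<le> n \<and> n < triangle (Suc (triangle_root n))"
  by (induction n) auto

lemma triangle_mono: "m \<le> n \<Longrightarrow> triangle m \<le> triangle n"
  by (induction n) (auto simp: le_Suc_eq)

text \<open>The code \<open>pair a b\<close> is \<open>triangle (a + b) + a\<close>, which lies
  before the next triangular number. Both components can then be recovered by subtraction.\<close>

lemma triangle_root_pair: "triangle_root (pair a b) = a + b"
proof -
  have "triangle (a + b) \<le> pair a b" "pair a b < triangle (Suc (a + b))"
    by (auto simp: pair_def prod_encode_def)
  with triangle_root_bounds[of "pair a b"] triangle_mono show ?thesis
    by (metis le_less_trans linorder_neqE_nat not_less less_eq_Suc_le)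
qed

lemma pfst_eq: "pfst z = z - triangle (triangle_root z)"
proof -
  have "triangle (triangle_root z) + pfst z = z"
    using triangle_root_pair[of "pfst z" "psnd z"] pair_pfst_psnd[of z, unfolded pair_def prod_encode_def prod.case]
    by (simp only: pair_pfst_psnd)
  then show ?thesis by linarith
qed

lemma psnd_eq: "psnd z = triangle_root z - pfst z"
  using triangle_root_pair[of "pfst z" "psnd z"] by (simp only: pair_pfst_psnd diff_add_inverse)

lemma computable_n_if_zero:
  assumes "computable_n k F" "computable_n k G" "computable_n k H"
  shows "computable_n k (\<lambda>xs. if F xs = 0 then G xs else H xs)"
proof -
  have "rec_nat a (\<lambda>_ _. b) c = (if c = 0 then a else b)" for a b c :: nat by (cases c) auto
  moreover have "computable_n k (\<lambda>xs. rec_nat (G xs) (\<lambda>_ _. H xs) (F xs))"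
    by (rule computable_n_rec) (use assms in \<open>auto intro: computable_n_drop2\<close>)
  ultimately show ?thesis by simp
qed

lemma computable_n_triangle_root:
  assumes "computable_n k F" shows "computable_n k (\<lambda>xs. triangle_root (F xs))"
proof -
  let ?s = "\<lambda>n y. if triangle (Suc y) - Suc n = 0 then Suc y else y"
  have "rec_nat 0 ?s a = triangle_root a" for a :: nat by (induction a) auto
  moreover have "computable_n k (\<lambda>xs. rec_nat 0 ?s (F xs))"
    by (rule computable_n_rec)
      (intro assms computable_n_zero computable_n_Suc computable_n_diff computable_n_triangle
        computable_n_if_zero computable_n_nth; simp)+
  ultimately show ?thesis by simp
qed

lemma computable_n_pair:
  "computable_n k F \<Longrightarrow> computable_n k G \<Longrightarrow> computable_n k (\<lambda>xs. pair (F xs) (G xs))"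
  unfolding pair_def prod_encode_def prod.case
  by (intro computable_n_add computable_n_triangle)

lemma computable_n_pfst: "computable_n k F \<Longrightarrow> computable_n k (\<lambda>xs. pfst (F xs))"
  unfolding pfst_eq by (intro computable_n_diff computable_n_triangle computable_n_triangle_root)

lemma computable_n_psnd: "computable_n k F \<Longrightarrow> computable_n k (\<lambda>xs. psnd (F xs))"
  unfolding psnd_eq by (intro computable_n_diff computable_n_pfst computable_n_triangle_root)

section \<open>Unary computable functions and decidable predicates\<close>

text \<open>Unary functions suffice: several variables are passed as nested pairs.\<close>

definition computable :: "(nat \<Rightarrow> nat) \<Rightarrow> bool" where
  "computable f \<longleftrightarrow> (\<exists>r. \<forall>x. computes r [x] (f x))"

definition dec :: "(nat \<Rightarrow> bool) \<Rightarrow> bool" where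
  "dec P \<longleftrightarrow> computable (\<lambda>x. of_bool (P x))"

named_theorems comp_intros

lemma computable_iff_computable_n: "computable f \<longleftrightarrow> computable_n 1 (\<lambda>xs. f (xs ! 0))"
proof -
  have "(\<forall>xs. length xs = 1 \<longrightarrow> computes r xs (f (xs ! 0))) \<longleftrightarrow> (\<forall>x. computes r [x] (f x))" for r
    by (auto simp: length_Suc_conv)
  then show ?thesis by (simp add: computable_def computable_n_def)
qed

lemma computable_const [comp_intros]: "computable (\<lambda>x. c)"
  unfolding computable_iff_computable_n
  by (induction c) (auto intro: computable_n_zero computable_n_Suc)

lemma computable_id [comp_intros]: "computable (\<lambda>x. x)"
  by (auto simp: computable_iff_computable_n intro: computable_n_nth)

lemma computable_Suc [comp_intros]: "computable f \<Longrightarrow> computable (\<lambda>x. Suc (f x))"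
  by (auto simp: computable_iff_computable_n intro: computable_n_Suc)

lemma computable_add [comp_intros]: "computable f \<Longrightarrow> computable g \<Longrightarrow> computable (\<lambda>x. f x + g x)"
  by (auto simp: computable_iff_computable_n intro: computable_n_add)

lemma computable_diff [comp_intros]: "computable f \<Longrightarrow> computable g \<Longrightarrow> computable (\<lambda>x. f x - g x)"
  by (auto simp: computable_iff_computable_n intro: computable_n_diff)

lemma computable_pair [comp_intros]: "computable f \<Longrightarrow> computable g \<Longrightarrow> computable (\<lambda>x. pair (f x) (g x))"
  by (auto simp: computable_iff_computable_n intro: computable_n_pair)

lemma computable_pfst [comp_intros]: "computable f \<Longrightarrow> computable (\<lambda>x. pfst (f x))"
  by (auto simp: computable_iff_computable_n intro: computable_n_pfst)

lemma computable_psnd [comp_intros]: "computable f \<Longrightarrow> computable (\<lambda>x. psnd (f x))"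
  by (auto simp: computable_iff_computable_n intro: computable_n_psnd)

lemma computable_comp: "computable f \<Longrightarrow> computable g \<Longrightarrow> computable (\<lambda>x. f (g x))"
  using computable_n_comp[of "[\<lambda>xs. g (xs ! 0)]" "\<lambda>xs. f (xs ! 0)" 1]
  by (simp add: computable_iff_computable_n)

lemma computable_rec [comp_intros]:
  assumes "computable f" "computable (\<lambda>w. g (pfst w) (pfst (psnd w)) (psnd (psnd w)))" "computable h"
  shows "computable (\<lambda>x. rec_nat (f x) (g x) (h x))"
proof -
  let ?g = "\<lambda>w. g (pfst w) (pfst (psnd w)) (psnd (psnd w))"
  have *: "computable_n (Suc (Suc 1)) (\<lambda>ys. ?g (pair (ys ! 2) (pair (ys ! 1) (ys ! 0))))"
    using computable_n_comp[of "[\<lambda>ys. pair (ys ! 2) (pair (ys ! 1) (ys ! 0))]" "\<lambda>xs. ?g (xs ! 0)" "Suc (Suc 1)"]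
      assms(2)
    by (simp add: computable_iff_computable_n computable_n_pair computable_n_nth del: pfst_pair psnd_pair)
  have "computable_n 1 (\<lambda>xs. rec_nat (f (xs ! 0)) (g (xs ! 0)) (h (xs ! 0)))"
  proof (rule computable_n_rec[where G = "\<lambda>xs. g (xs ! 0)"])
    show "computable_n (Suc (Suc 1)) (\<lambda>ys. g (tl (tl ys) ! 0) (ys ! 1) (ys ! 0))"
      by (rule iffD1[OF computable_n_cong *]) (auto simp: length_Suc_conv)
  qed (use assms in \<open>auto simp: computable_iff_computable_n\<close>)
  then show ?thesis by (simp add: computable_iff_computable_n)
qed

lemma computable_mult [comp_intros]:
  assumes "computable f" "computable g" shows "computable (\<lambda>x. f x * g x)"
proof -
  have "rec_nat 0 (\<lambda>_ y. y + a) b = a * b" for a b :: nat by (induction b) auto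
  moreover have "computable (\<lambda>x. rec_nat 0 (\<lambda>_ y. y + f x) (g x))"
    by (intro comp_intros assms computable_comp[OF assms(1)])
  ultimately show ?thesis by simp
qed

lemma computable_power [comp_intros]:
  assumes "computable f" "computable g" shows "computable (\<lambda>x. f x ^ g x)"
proof -
  have "rec_nat 1 (\<lambda>_ y. y * a) b = a ^ b" for a b :: nat by (induction b) auto
  moreover have "computable (\<lambda>x. rec_nat 1 (\<lambda>_ y. y * f x) (g x))"
    by (intro comp_intros assms computable_comp[OF assms(1)])
  ultimately show ?thesis by simp
qed

lemma dec_comp: "dec P \<Longrightarrow> computable f \<Longrightarrow> dec (\<lambda>x. P (f x))"
  unfolding dec_def by (rule computable_comp)

lemma dec_le [comp_intros]:
  assumes "computable f" "computable g" shows "dec (\<lambda>x. f x \<le> g x)"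
proof -
  have "of_bool (a \<le> b) = 1 - (a - b)" for a b :: nat by auto
  then show ?thesis using assms by (auto simp: dec_def intro!: comp_intros)
qed

lemma dec_less [comp_intros]: "computable f \<Longrightarrow> computable g \<Longrightarrow> dec (\<lambda>x. f x < g x)"
  unfolding less_eq_Suc_le by (intro comp_intros)

lemma dec_not [comp_intros]: "dec P \<Longrightarrow> dec (\<lambda>x. \<not> P x)"
proof -
  have "of_bool (\<not> b) = 1 - (of_bool b :: nat)" for b by simp
  then show "dec P \<Longrightarrow> ?thesis" unfolding dec_def by (simp add: computable_diff computable_const)
qed

lemma dec_conj [comp_intros]: "dec P \<Longrightarrow> dec Q \<Longrightarrow> dec (\<lambda>x. P x \<and> Q x)"
  unfolding dec_def of_bool_conj by (intro comp_intros)

lemma dec_disj [comp_intros]: "dec P \<Longrightarrow> dec Q \<Longrightarrow> dec (\<lambda>x. P x \<or> Q x)"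
  using dec_not[OF dec_conj[OF dec_not dec_not]] by simp

lemma dec_imp [comp_intros]: "dec P \<Longrightarrow> dec Q \<Longrightarrow> dec (\<lambda>x. P x \<longrightarrow> Q x)"
  unfolding imp_conv_disj by (intro dec_disj dec_not)

lemma dec_const [comp_intros]: "dec (\<lambda>x. b)"
  unfolding dec_def by (intro comp_intros)

lemma dec_eq [comp_intros]: "computable f \<Longrightarrow> computable g \<Longrightarrow> dec (\<lambda>x. f x = g x)"
  unfolding order_eq_iff by (intro comp_intros)

lemma computable_if [comp_intros]:
  assumes "dec P" "computable f" "computable g" shows "computable (\<lambda>x. if P x then f x else g x)"
proof -
  have eq: "(if b then m else n) = of_bool b * m + (1 - of_bool b) * n" for b and m n :: nat
    by simp
  have "computable (\<lambda>x. of_bool (P x) * f x + (1 - of_bool (P x)) * g x)"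
    using assms(1)[unfolded dec_def] by (intro comp_intros assms)
  then show ?thesis unfolding eq .
qed

lemma dec_ex_less [comp_intros]:
  assumes P: "dec (\<lambda>w. P (pfst w) (psnd w))" and b: "computable b"
  shows "dec (\<lambda>x. \<exists>i<b x. P x i)"
proof -
  have eq: "rec_nat 0 (\<lambda>i y. if P x i then 1 else y) n = of_bool (\<exists>i<n. P x i)" for x n
    by (induction n) (auto simp: less_Suc_eq)
  have "computable (\<lambda>x. rec_nat 0 (\<lambda>i y. if P x i then 1 else y) (b x))"
    using dec_comp[OF P, of "\<lambda>w. pair (pfst w) (pfst (psnd w))"]
    unfolding pfst_pair psnd_pair by (intro comp_intros b) (simp add: comp_intros)
  then show ?thesis unfolding eq dec_def .
qed

lemma dec_all_less [comp_intros]: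
  assumes P: "dec (\<lambda>w. P (pfst w) (psnd w))" and b: "computable b"
  shows "dec (\<lambda>x. \<forall>i<b x. P x i)"
  using dec_not[OF dec_ex_less[OF dec_not[OF P] b]] by simp

lemma computable_mod [comp_intros]:
  assumes "computable f" "computable g" shows "computable (\<lambda>x. f x mod g x)"
proof -
  \<comment> \<open>The recursion counts up to \<open>b\<close> and restarts. For
    \<open>b = 0\<close> it never restarts, in accordance with \<open>a mod 0 = a\<close>.\<close>
  let ?s = "\<lambda>b n y. if Suc y = b then 0 else Suc y"
  have eq: "rec_nat 0 (?s b) a = a mod b" for a b :: nat
    by (induction a) (simp_all only: old.nat.rec mod_Suc mod_0)
  have "computable (\<lambda>x. rec_nat 0 (?s (g x)) (f x))"
    by (intro comp_intros assms computable_comp[OF assms(2)])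
  then show ?thesis unfolding eq .
qed

lemma computable_div [comp_intros]:
  assumes "computable f" "computable g" shows "computable (\<lambda>x. f x div g x)"
proof -
  let ?s = "\<lambda>b n y. if Suc n mod b = 0 then Suc y else y"
  have eq: "rec_nat 0 (?s b) a = a div b" for a b :: nat
    by (induction a) (simp_all only: old.nat.rec div_Suc div_0)
  have "computable (\<lambda>x. rec_nat 0 (?s (g x)) (f x))"
    by (intro comp_intros assms computable_comp[OF assms(2)])
  then show ?thesis unfolding eq .
qed

lemma dec_even [comp_intros]: "computable f \<Longrightarrow> dec (\<lambda>x. even (f x))"
  unfolding even_iff_mod_2_eq_zero by (intro comp_intros)

lemma dec_set_decode [comp_intros]:
  "computable f \<Longrightarrow> computable g \<Longrightarrow> dec (\<lambda>x. f x \<in> set_decode (g x))"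
  unfolding set_decode_def mem_Collect_eq by (intro comp_intros)

section \<open>Reachability in bounded graphs\<close>

lemma set_encode_less: assumes "A \<subseteq> {..<b}" shows "set_encode A < 2 ^ b"
proof -
  have "set_encode A \<le> set_encode {..<b}"
    unfolding set_encode_def by (rule sum_mono2) (use assms in auto)
  also have "\<dots> < 2 ^ b" unfolding set_encode_def
    by (induction b) auto
  finally show ?thesis .
qed

text \<open>A vertex is reachable from \<open>a\<close> iff it lies in every closed set containing
  \<open>a\<close>, and subsets of the vertices have codes below \<open>2 ^ b\<close>. Equality is a
  separate case because the reflexive closure also relates numbers outside the bound to
  themselves.\<close>

lemma dec_rtranclp [comp_intros]:
  assumes R: "dec (\<lambda>w. R (pfst w) (pfst (psnd w)) (psnd (psnd w)))"
    and b: "computable b" and f: "computable f" and g: "computable g"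
  shows "dec (\<lambda>x. (\<lambda>i j. i < b x \<and> j < b x \<and> R x i j)\<^sup>*\<^sup>* (f x) (g x))"
proof -
  have eq: "(\<lambda>i j. i < b \<and> j < b \<and> R i j)\<^sup>*\<^sup>* a c \<longleftrightarrow>
     a = c \<or> (a < b \<and> (\<forall>s<2^b. a \<in> set_decode s \<and>
        (\<forall>i<b. \<forall>j<b. i \<in> set_decode s \<and> R i j \<longrightarrow> j \<in> set_decode s) \<longrightarrow> c \<in> set_decode s))"
    (is "?R\<^sup>*\<^sup>* a c \<longleftrightarrow> ?rhs") for R and a b c :: nat
  proof
    assume r: "?R\<^sup>*\<^sup>* a c"
    show ?rhs
    proof (cases "a = c")
      case False
      have "a < b" using r False by (auto elim: converse_rtranclpE)
      moreover have "c \<in> set_decode s" if s: "a \<in> set_decode s \<and>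
        (\<forall>i<b. \<forall>j<b. i \<in> set_decode s \<and> R i j \<longrightarrow> j \<in> set_decode s)" for s
        using r
      proof induction
        case base
        show ?case using s by (rule conjunct1)
      next
        case (step y z)
        then have "y \<in> set_decode s" "y < b" "z < b" "R y z" by auto
        with s show ?case by blast
      qed
      ultimately show ?thesis
        by (intro disjI2 conjI allI impI)
    qed simp
  next
    assume rhs: ?rhs
    show "?R\<^sup>*\<^sup>* a c"
    proof (cases "a = c")
      case False
      \<comment> \<open>The set of reachable vertices is itself one of the closed sets quantified
        over.\<close>
      let ?S = "{d. d < b \<and> ?R\<^sup>*\<^sup>* a d}"
      have S: "set_decode (set_encode ?S) = ?S" by simp
      have "set_encode ?S < 2 ^ b" by (rule set_encode_less) auto
      moreover have "a \<in> set_decode (set_encode ?S)" using False rhs by (simp add: S)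
      moreover have "\<forall>i<b. \<forall>j<b. i \<in> set_decode (set_encode ?S) \<and> R i j \<longrightarrow> j \<in> set_decode (set_encode ?S)"
        unfolding S by (auto intro: rtranclp.rtrancl_into_rtrancl)
      ultimately have "c \<in> set_decode (set_encode ?S)" using False rhs by blast
      then show ?thesis by (simp add: S)
    qed simp
  qed
  have "dec (\<lambda>x. f x = g x \<or> (f x < b x \<and> (\<forall>s<2^b x. f x \<in> set_decode s \<and>
        (\<forall>i<b x. \<forall>j<b x. i \<in> set_decode s \<and> R x i j \<longrightarrow> j \<in> set_decode s) \<longrightarrow> g x \<in> set_decode s)))"
    using b f g dec_comp[OF R, of "\<lambda>w. pair (pfst (pfst (pfst w))) (pair (psnd (pfst w)) (psnd w))"]
    by (intro comp_intros computable_comp[OF b] computable_comp[OF f] computable_comp[OF g])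
      (simp_all add: comp_intros)
  then show ?thesis unfolding eq .
qed

section \<open>Contracting the number line\<close>

lemma rtranclp_map:
  assumes "R\<^sup>*\<^sup>* x y" and "\<And>x y. R x y \<Longrightarrow> S (f x) (f y)"
  shows "S\<^sup>*\<^sup>* (f x) (f y)"
  using assms(1)
proof induction
  case (step y z)
  then show ?case using assms(2) by (meson rtranclp.rtrancl_into_rtrancl)
qed simp

text \<open>In the applications \<open>X\<close> indexes all marked positions, constants included.
  By \<open>step_inv\<close> a step depends only on the counter difference and on how the source
  value compares with the marked positions. Strict comparison is included because of the loops that
  stay above all tests.\<close>

locale counter_system =
  fixes step :: "('x \<Rightarrow> nat) \<Rightarrow> 's \<times> nat \<Rightarrow> 's \<times> nat \<Rightarrow> bool"
    and Q :: "'s set" and X :: "'x set" and w :: nat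
  assumes finite_Q: "finite Q" and finite_X: "finite X"
    and step_bound: "step \<nu> (s, c) (s', c') \<Longrightarrow> s \<in> Q \<and> s' \<in> Q \<and> c' \<le> c + w \<and> c \<le> c' + w"
    and step_inv: "\<lbrakk>step \<nu> (s, c) (s', c'); c' + e = e' + c;
      \<And>x. x \<in> X \<Longrightarrow> (\<nu> x = c \<longleftrightarrow> \<nu>' x = e) \<and> (\<nu> x < c \<longleftrightarrow> \<nu>' x < e)\<rbrakk>
      \<Longrightarrow> step \<nu>' (s, e) (s', e')"
begin

definition cap :: "('x \<Rightarrow> nat) \<Rightarrow> nat \<Rightarrow> 's \<times> nat \<Rightarrow> 's \<times> nat \<Rightarrow> bool" where
  "cap \<nu> M p q \<longleftrightarrow> step \<nu> p q \<and> snd p \<le> M \<and> snd q \<le> M"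

definition up :: "('x \<Rightarrow> nat) \<Rightarrow> nat \<Rightarrow> nat \<Rightarrow> 's \<times> nat \<Rightarrow> 's \<times> nat \<Rightarrow> bool" where
  "up \<nu> M h p q \<longleftrightarrow> cap \<nu> M p q \<and> h \<le> snd p"

text \<open>The excursions above \<open>h\<close>, with entry and exit positions relative to \<open>h\<close>. All sources of
  steps lie above \<open>h\<close>, so the step that leaves the region is part of the excursion.\<close>

definition excursions :: "('x \<Rightarrow> nat) \<Rightarrow> nat \<Rightarrow> nat \<Rightarrow> (('s \<times> nat) \<times> ('s \<times> nat)) set" where
  "excursions \<nu> M h = {((s, i), (s', j)). s \<in> Q \<and> s' \<in> Q \<and> i \<le> w \<and> 0 < j \<and> j \<le> w \<and>
     (up \<nu> M h)\<^sup>*\<^sup>* (s, h + i) (s', h - j)}"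

text \<open>Since \<open>w < h\<close>, the subtractions \<open>h - j\<close> with \<open>j\<close>
  \<le> \<open>w\<close> are not truncated. By \<open>gap\<close> no marked position lies in the
  deleted segment, so every position that \<open>\<nu>'\<close> moves is at least
  \<open>h'\<close>.\<close>

context
  fixes \<nu> \<nu>' :: "'x \<Rightarrow> nat" and M h h' :: nat
  assumes h: "w < h" "h < h'" "h' \<le> M"
    and same: "excursions \<nu> M h = excursions \<nu> M h'"
    and gap: "\<And>x. x \<in> X \<Longrightarrow> \<nu> x < h' \<Longrightarrow> \<nu> x < h"
    and \<nu>': "\<nu>' = (\<lambda>x. if x \<in> X \<and> h \<le> \<nu> x then \<nu> x - (h' - h) else \<nu> x)"
begin

text \<open>Marked positions below \<open>h\<close> stay; the others are at least \<open>h'\<close>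
  before and at least \<open>h\<close> after the change. So a source below \<open>h\<close> compares
  with all of them as before, and the target may lie on either side of the cut.\<close>

lemma contract_low:
  assumes "step \<nu> (s, c) (s', c')" "c < h"
  shows "step \<nu>' (s, c) (s', c')"
proof (rule step_inv[OF assms(1)])
  fix x assume "x \<in> X"
  with gap[of x] assms(2) h show "(\<nu> x = c \<longleftrightarrow> \<nu>' x = c) \<and> (\<nu> x < c \<longleftrightarrow> \<nu>' x < c)"
    by (cases "\<nu> x < h'") (auto simp: \<nu>')
qed simp

text \<open>Positions above the deleted segment move along with the source, and those below
  \<open>h\<close> stay below the shifted source, which is at least \<open>h\<close>.\<close>

lemma contract_high:
  assumes "step \<nu> (s, c) (s', c')" "h' \<le> c" "h' - h \<le> c'"
  shows "step \<nu>' (s, c - (h' - h)) (s', c' - (h' - h))"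
proof (rule step_inv[OF assms(1)])
  fix x assume "x \<in> X"
  with gap[of x] assms(2) h
  show "(\<nu> x = c \<longleftrightarrow> \<nu>' x = c - (h' - h)) \<and> (\<nu> x < c \<longleftrightarrow> \<nu>' x < c - (h' - h))"
    by (cases "\<nu> x < h'") (auto simp: \<nu>')
qed (use assms h in auto)

lemma contract_excursion:
  assumes "(up \<nu> M h')\<^sup>*\<^sup>* p q" "h' - h \<le> snd p" "h' - h \<le> snd q"
  shows "(cap \<nu>' (M - (h' - h)))\<^sup>*\<^sup>* (fst p, snd p - (h' - h)) (fst q, snd q - (h' - h))"
  using assms
proof induction
  case (step q r)
  then have q: "h' \<le> snd q" "step \<nu> q r" "snd q \<le> M" "snd r \<le> M" by (auto simp: up_def cap_def)
  with contract_high[of "fst q" "snd q" "fst r" "snd r"] step.prems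
  have "cap \<nu>' (M - (h' - h)) (fst q, snd q - (h' - h)) (fst r, snd r - (h' - h))"
    by (auto simp: cap_def)
  moreover have "h' - h \<le> snd q" using q by simp
  ultimately show ?case using step by (meson rtranclp.rtrancl_into_rtrancl)
qed simp

text \<open>Steps with source below \<open>h\<close> are kept. An excursion above \<open>h\<close>
  has its relative end points in \<open>excursions \<nu> M h\<close>, hence in
  \<open>excursions \<nu> M h'\<close>. The excursion above \<open>h'\<close> obtained from there,
  shifted down by \<open>h' - h\<close>, joins the original entry and exit and respects the smaller
  cap.\<close>

lemma contract:
  assumes "(cap \<nu> M)\<^sup>*\<^sup>* a b" "snd a < h" "snd b < h"
  shows "(cap \<nu>' (M - (h' - h)))\<^sup>*\<^sup>* a b"
proof -
  let ?R = "(cap \<nu>' (M - (h' - h)))\<^sup>*\<^sup>*"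
  \<comment> \<open>above \<open>h\<close> the last entry into the region is remembered\<close>
  have "(snd q < h \<and> ?R a q) \<or>
        (h \<le> snd q \<and> (\<exists>p e. ?R a p \<and> snd p < h \<and> h \<le> snd e \<and> cap \<nu> M p e \<and> (up \<nu> M h)\<^sup>*\<^sup>* e q))"
    if "(cap \<nu> M)\<^sup>*\<^sup>* a q" for q
    using that
  proof induction
    case base
    then show ?case using assms(2) by simp
  next
    case (step q r)
    then have qr: "cap \<nu> M q r" by simp
    show ?case
    proof (cases "snd q < h")
      case True
      with step have aq: "?R a q" by simp
      show ?thesis
      proof (cases "snd r < h")
        case False
        with True qr aq show ?thesis
          by (intro disjI2 conjI exI[of _ q] exI[of _ r]) simp_all
      next
        case r: True
        have "step \<nu>' q r"
          using contract_low[of "fst q" "snd q" "fst r" "snd r"] qr True by (simp add: cap_def)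
        \<comment> \<open>Values below \<open>h\<close> respect the new cap because
          \<open>h'\<close> \<le> \<open>M\<close>.\<close>
        with True r h have "cap \<nu>' (M - (h' - h)) q r" by (auto simp: cap_def)
        with aq r show ?thesis by (meson rtranclp.rtrancl_into_rtrancl)
      qed
    next
      case False
      with step obtain p e where pe: "?R a p" "snd p < h" "h \<le> snd e" "cap \<nu> M p e"
          "(up \<nu> M h)\<^sup>*\<^sup>* e q" by auto
      have "up \<nu> M h q r" using False qr by (simp add: up_def)
      with pe have er: "(up \<nu> M h)\<^sup>*\<^sup>* e r" by (meson rtranclp.rtrancl_into_rtrancl)
      show ?thesis
      proof (cases "snd r < h")
        case False
        with pe er show ?thesis
          by (intro disjI2 conjI exI[of _ p] exI[of _ e]) simp_all
      next
        case True
        have "fst e \<in> Q" "snd e \<le> snd p + w"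
          using pe step_bound[of \<nu> "fst p" "snd p" "fst e" "snd e"]
          by (simp_all add: cap_def)
        moreover from this pe have "snd e - h \<le> w" "e = (fst e, h + (snd e - h))"
          by (linarith, simp add: prod_eq_iff)
        ultimately obtain u i where e: "e = (u, h + i)" "u \<in> Q" "i \<le> w" by blast
        have "fst r \<in> Q" "snd q \<le> snd r + w"
          using qr step_bound[of \<nu> "fst q" "snd q" "fst r" "snd r"]
          by (simp_all add: cap_def)
        moreover from this True False have "0 < h - snd r" "h - snd r \<le> w" "r = (fst r, h - (h - snd r))"
          by (linarith, linarith, simp add: prod_eq_iff)
        ultimately obtain v j where r: "r = (v, h - j)" "v \<in> Q" "0 < j" "j \<le> w" by blast
        have "((u, i), (v, j)) \<in> excursions \<nu> M h"
          using e r er by (simp add: excursions_def)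
        with same have ex: "(up \<nu> M h')\<^sup>*\<^sup>* (u, h' + i) (v, h' - j)"
          by (simp add: excursions_def)
        \<comment> \<open>Start and end differ, so the excursion above \<open>h'\<close> has a first
          step, and this step bounds \<open>h' + i\<close> by \<open>M\<close>. That is what puts
          the entry point \<open>e\<close> under the new cap.\<close>
        moreover have "h' + i \<noteq> h' - j" using h r(3) by linarith
        ultimately have "h' + i \<le> M"
          by (metis converse_rtranclpE up_def cap_def snd_conv)
        then have "snd e \<le> M - (h' - h)" using h e by simp
        moreover have "step \<nu>' p e"
          using contract_low[of "fst p" "snd p" "fst e" "snd e"] pe by (simp add: cap_def)
        ultimately have "cap \<nu>' (M - (h' - h)) p e" using pe h by (simp add: cap_def)
        moreover have "?R e r"
        proof -
          have "h' + i - (h' - h) = h + i" "h' - j - (h' - h) = h - j" using h r by auto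
          with contract_excursion[OF ex] h r e show ?thesis by simp
        qed
        ultimately have "?R a r" using pe(1)
          by (meson rtranclp.rtrancl_into_rtrancl rtranclp_trans)
        with True show ?thesis by simp
      qed
    qed
  qed
  from this[OF assms(1)] assms(3) show ?thesis by simp
qed

end

lemma excursions_subset: "excursions \<nu> M h \<subseteq> (Q \<times> {..w}) \<times> (Q \<times> {..w})"
  by (auto simp: excursions_def)

lemma rtranclp_step_cap:
  assumes "(step \<nu>)\<^sup>*\<^sup>* a b" shows "\<exists>M. (cap \<nu> M)\<^sup>*\<^sup>* a b"
  using assms
proof induction
  case (step q r)
  then obtain M where M: "(cap \<nu> M)\<^sup>*\<^sup>* a q" by blast
  let ?M = "M + snd q + snd r"
  have "cap \<nu> M \<le> cap \<nu> ?M" by (auto simp: cap_def)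
  with M have "(cap \<nu> ?M)\<^sup>*\<^sup>* a q" using rtranclp_mono by blast
  moreover have "cap \<nu> ?M q r" using step by (simp add: cap_def)
  ultimately show ?case by (meson rtranclp.rtrancl_into_rtrancl)
qed blast

text \<open>The least cap over all admissible valuations is taken, and the cuts between
  \<open>K\<close> and this cap are compared by the pigeonhole principle. Contraction changes only
  values above \<open>K\<close>, so constants survive if \<open>K\<close> is at least as large as
  they are.\<close>

theorem small_valuation:
  assumes ab: "(step \<nu>)\<^sup>*\<^sup>* a b"
    and K: "w \<le> K" "snd a \<le> K" "snd b \<le> K"
  shows "\<exists>\<nu>' M. M \<le> K + 2 ^ ((card Q * Suc w)\<^sup>2) * 2 ^ card X \<and> (cap \<nu>' M)\<^sup>*\<^sup>* a b \<and>
    (\<forall>x. x \<notin> X \<or> \<nu> x \<le> K \<longrightarrow> \<nu>' x = \<nu> x)"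
proof -
  define P where "P M \<mu> \<longleftrightarrow> (cap \<mu> M)\<^sup>*\<^sup>* a b \<and> (\<forall>x. x \<notin> X \<or> \<nu> x \<le> K \<longrightarrow> \<mu> x = \<nu> x)" for M \<mu>
  have "\<exists>M. \<exists>\<mu>. P M \<mu>" using rtranclp_step_cap[OF ab] by (auto simp: P_def)
  then obtain M where "\<exists>\<mu>. P M \<mu>" and least: "\<And>M'. M' < M \<Longrightarrow> \<nexists>\<mu>. P M' \<mu>"
    using exists_least_iff[of "\<lambda>M. \<exists>\<mu>. P M \<mu>"] by blast
  then obtain \<mu> where \<mu>: "P M \<mu>" by blast
  \<comment> \<open>two cuts with the same image under \<open>?f\<close> could be contracted, against the choice of \<open>M\<close>\<close>
  let ?T = "Pow ((Q \<times> {..w}) \<times> (Q \<times> {..w})) \<times> Pow X"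
  let ?f = "\<lambda>h. (excursions \<mu> M h, {x \<in> X. \<mu> x < h})"
  have cardT: "card ?T = 2 ^ ((card Q * Suc w)\<^sup>2) * 2 ^ card X"
    by (simp add: card_cartesian_product card_Pow finite_Q finite_X power2_eq_square)
  have "M \<le> K + card ?T"
  proof (rule ccontr)
    assume "\<not> M \<le> K + card ?T"
    moreover have "?f ` {K<..M} \<subseteq> ?T" using excursions_subset by auto
    moreover have "finite ?T" using finite_Q finite_X by simp
    ultimately have "\<not> inj_on ?f {K<..M}"
      using card_inj_on_le[of ?f "{K<..M}" ?T] by auto
    then obtain h1 h2 where h12: "h1 \<in> {K<..M}" "h2 \<in> {K<..M}" "h1 \<noteq> h2" "?f h1 = ?f h2"
      unfolding inj_on_def by blast
    obtain h h' where h: "K < h" "h < h'" "h' \<le> M" "?f h = ?f h'"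
    proof (cases "h1 < h2")
      case True
      with h12 that[of h1 h2] show ?thesis by simp
    next
      case False
      with h12 that[of h2 h1] show ?thesis by simp
    qed
    let ?\<mu> = "\<lambda>x. if x \<in> X \<and> h \<le> \<mu> x then \<mu> x - (h' - h) else \<mu> x"
    have gap: "\<mu> x < h" if "x \<in> X" "\<mu> x < h'" for x using h(4) that by blast
    have "(cap ?\<mu> (M - (h' - h)))\<^sup>*\<^sup>* a b"
      by (rule contract[where \<nu> = \<mu>]) (use h K gap \<mu> in \<open>auto simp: P_def\<close>)
    moreover have "?\<mu> x = \<nu> x" if "x \<notin> X \<or> \<nu> x \<le> K" for x
    proof -
      have "\<mu> x = \<nu> x" using \<mu> that by (auto simp: P_def)
      with that h show ?thesis by auto
    qed
    ultimately have "P (M - (h' - h)) ?\<mu>" by (simp add: P_def)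
    moreover have "M - (h' - h) < M" using h by simp
    ultimately show False using least by blast
  qed
  with \<mu> show ?thesis unfolding cardT P_def by blast
qed

end

section \<open>Bounded search for a valuation\<close>

lemma pair_mono: "a \<le> a' \<Longrightarrow> b \<le> b' \<Longrightarrow> pair a b \<le> pair a' b'"
  by (simp add: pair_def prod_encode_def add_mono triangle_mono)

text \<open>One number holds the values of \<open>N\<close> parameters as digits in base
  \<open>D\<close>, which makes the search for a valuation a bounded search.\<close>

lemma digits_exist:
  assumes "\<And>t. t < N \<Longrightarrow> g t < D"
  shows "\<exists>m<D ^ N. \<forall>t<N. (m div D ^ t) mod D = (g t :: nat)"
  using assms
proof (induction N)
  case (Suc N)
  then obtain m where m: "m < D ^ N" "\<And>t. t < N \<Longrightarrow> (m div D ^ t) mod D = g t"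
    by (meson less_SucI)
  have D: "0 < D" "g N < D" using Suc.prems[of N] by auto
  have "m + g N * D ^ N < Suc (g N) * D ^ N" using m by simp
  also have "\<dots> \<le> D * D ^ N" using D by (intro mult_right_mono) auto
  finally have "m + g N * D ^ N < D ^ Suc N" by simp
  moreover have "((m + g N * D ^ N) div D ^ t) mod D = g t" if "t < Suc N" for t
  proof (cases "t = N")
    case True
    then show ?thesis using m D by simp
  next
    case False
    \<comment> \<open>The new leading digit contributes a multiple of \<open>D * D ^ t\<close>,
      which vanishes modulo \<open>D\<close> after division by \<open>D ^ t\<close>.\<close>
    with that obtain k where k: "N = t + Suc k" by (metis less_SucE less_imp_Suc_add add_Suc_right)
    have "D ^ N = D ^ Suc k * D ^ t" unfolding k power_add by (rule mult.commute)
    then have "(m + g N * D ^ N) div D ^ t = (m + g N * D ^ Suc k * D ^ t) div D ^ t"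
      by (simp only: mult.assoc)
    also have "\<dots> = m div D ^ t + (g N * D ^ k) * D"
      using D by (subst div_mult_self1) simp_all
    finally show ?thesis using m(2)[of t] k by simp
  qed
  ultimately show ?case by blast
qed simp

text \<open>Even numbers code constants; the values of the odd ones are the digits of \<open>m\<close> in base \<open>D\<close>.\<close>

definition val :: "nat \<Rightarrow> nat \<Rightarrow> nat \<Rightarrow> nat" where
  "val D m t = (if even t then t div 2 else (m div D ^ t) mod D)"

lemma computable_val [comp_intros]:
  "computable d \<Longrightarrow> computable m \<Longrightarrow> computable t \<Longrightarrow> computable (\<lambda>x. val (d x) (m x) (t x))"
  unfolding val_def by (intro comp_intros)

theorem dec_parameterised_reachability:
  fixes step :: "nat \<Rightarrow> (nat \<Rightarrow> nat) \<Rightarrow> nat \<times> nat \<Rightarrow> nat \<times> nat \<Rightarrow> bool"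
  assumes system: "\<And>n. counter_system (step n) {..<q n} {..<N n} (w n)"
    and step: "\<And>f d m s c s' c'. \<lbrakk>computable f; computable d; computable m; computable s; computable c;
      computable s'; computable c'\<rbrakk> \<Longrightarrow> dec (\<lambda>z. step (f z) (val (d z) (m z)) (s z, c z) (s' z, c' z))"
    and q: "computable q" and N: "computable N" and w: "computable w"
    and a: "computable s" "computable c" and b: "computable s'" "computable c'"
  shows "dec (\<lambda>n. \<exists>\<nu>. (\<forall>i. \<nu> (2 * i) = i) \<and> (step n \<nu>)\<^sup>*\<^sup>* (s n, c n) (s' n, c' n))"
proof -
  \<comment> \<open>The summand \<open>N n\<close> keeps the constants fixed: a constant with code
    below \<open>N n\<close> is at most \<open>N n\<close>, hence at most
    \<open>K n\<close>.\<close>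
  define K where "K n = w n + c n + c' n + N n" for n
  define B where "B n = K n + 2 ^ (q n * Suc (w n))\<^sup>2 * 2 ^ N n" for n
  \<comment> \<open>Digits run up to \<open>B n + 1\<close>, which stands for all larger values:
    counters are at most \<open>B n\<close> and compare with all of these in the same way.\<close>
  define D where "D n = B n + 2" for n
  define b where "b n = Suc (pair (q n) (B n))" for n
  have [comp_intros]: "computable K" unfolding K_def by (intro comp_intros w a b N)
  have [comp_intros]: "computable B"
    unfolding B_def power2_eq_square by (intro comp_intros w q N)
  have D: "computable D" unfolding D_def by (intro comp_intros)
  have b': "computable b" unfolding b_def by (intro comp_intros q)
  let ?R = "\<lambda>n m i j. step n (val (D n) m) (pfst i, psnd i) (pfst j, psnd j)"
  let ?cR = "\<lambda>n m i j. i < b n \<and> j < b n \<and> ?R n m i j"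
  have eq: "(\<exists>\<nu>. (\<forall>i. \<nu> (2 * i) = i) \<and> (step n \<nu>)\<^sup>*\<^sup>* (s n, c n) (s' n, c' n)) \<longleftrightarrow>
    (\<exists>m<D n ^ N n. (?cR n m)\<^sup>*\<^sup>* (pair (s n) (c n)) (pair (s' n) (c' n)))" (is "?lhs \<longleftrightarrow> ?rhs") for n
  proof
    assume ?lhs
    then obtain \<nu> where \<nu>: "\<And>i. \<nu> (2 * i) = i" "(step n \<nu>)\<^sup>*\<^sup>* (s n, c n) (s' n, c' n)" by blast
    interpret counter_system "step n" "{..<q n}" "{..<N n}" "w n" by (rule system)
    obtain \<mu> M where M: "M \<le> B n" and \<mu>: "(cap \<mu> M)\<^sup>*\<^sup>* (s n, c n) (s' n, c' n)"
      and eq: "\<And>x. x \<notin> {..<N n} \<or> \<nu> x \<le> K n \<Longrightarrow> \<mu> x = \<nu> x"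
      using small_valuation[OF \<nu>(2), of "K n"] by (auto simp: K_def B_def)
    have "min (\<mu> t) (Suc (B n)) < D n" for t by (simp add: D_def)
    then obtain m where m: "m < D n ^ N n"
      "\<And>t. t < N n \<Longrightarrow> (m div D n ^ t) mod D n = min (\<mu> t) (Suc (B n))"
      using digits_exist[of "N n" "\<lambda>t. min (\<mu> t) (Suc (B n))" "D n"] by blast
    have val: "val (D n) m x = (if even x then \<mu> x else min (\<mu> x) (Suc (B n)))" if "x < N n" for x
    proof (cases "even x")
      case True
      then obtain i where "x = 2 * i" by blast
      with that \<nu>(1)[of i] eq[of x] show ?thesis by (simp add: val_def K_def)
    next
      case False
      with m(2) that show ?thesis by (simp add: val_def)
    qed
    have "(?cR n m)\<^sup>*\<^sup>* (pair (fst (s n, c n)) (snd (s n, c n))) (pair (fst (s' n, c' n)) (snd (s' n, c' n)))"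
      using \<mu>
    proof (rule rtranclp_map)
      fix x y assume xy: "cap \<mu> M x y"
      then have st: "step n \<mu> (fst x, snd x) (fst y, snd y)" and le: "snd x \<le> B n" "snd y \<le> B n"
        using M by (auto simp: cap_def)
      have "step n (val (D n) m) (fst x, snd x) (fst y, snd y)"
        by (rule step_inv[OF st]) (use le in \<open>auto simp: val min_def\<close>)
      moreover have "pair (fst x) (snd x) < b n" "pair (fst y) (snd y) < b n"
        using step_bound[OF st] le by (auto simp: b_def less_Suc_eq_le intro!: pair_mono)
      ultimately show "?cR n m (pair (fst x) (snd x)) (pair (fst y) (snd y))" by simp
    qed
    with m(1) show ?rhs by auto
  next
    assume ?rhs
    then obtain m where "(?cR n m)\<^sup>*\<^sup>* (pair (s n) (c n)) (pair (s' n) (c' n))" by blast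
    then have "(step n (val (D n) m))\<^sup>*\<^sup>* (pfst (pair (s n) (c n)), psnd (pair (s n) (c n)))
       (pfst (pair (s' n) (c' n)), psnd (pair (s' n) (c' n)))"
      by (rule rtranclp_map[where f = "\<lambda>i. (pfst i, psnd i)"]) simp
    then show ?lhs by (intro exI[of _ "val (D n) m"]) (simp add: val_def)
  qed
  show ?thesis
    unfolding eq
    by (intro comp_intros step computable_comp[OF D] computable_comp[OF N] computable_comp[OF b']
        computable_comp[OF a(1)] computable_comp[OF a(2)] computable_comp[OF b(1)] computable_comp[OF b(2)])
qed

section \<open>Coded automata\<close>

text \<open>\<open>list_encode\<close> maps a nonempty list to the successor of a pair code and the
  empty list to 0.\<close>

definition hdc :: "nat \<Rightarrow> nat" where "hdc z = pfst (z - 1)"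
definition tlc :: "nat \<Rightarrow> nat" where "tlc z = psnd (z - 1)"

lemma hdc_Cons [simp]: "hdc (list_encode (x # xs)) = x"
  by (simp add: hdc_def pfst_def)

lemma tlc_Cons [simp]: "tlc (list_encode (x # xs)) = list_encode xs"
  by (simp add: tlc_def psnd_def)

lemma computable_hdc [comp_intros]: "computable f \<Longrightarrow> computable (\<lambda>x. hdc (f x))"
  unfolding hdc_def by (intro comp_intros)

lemma computable_tlc [comp_intros]: "computable f \<Longrightarrow> computable (\<lambda>x. tlc (f x))"
  unfolding tlc_def by (intro comp_intros)

lemma le_pair: "a \<le> pair a b" "b \<le> pair a b"
  by (simp_all add: pair_def le_prod_encode_1 le_prod_encode_2)

lemma hdc_le: "hdc z \<le> z"
  using le_pair(1)[of "pfst (z - 1)" "psnd (z - 1)"] by (simp add: hdc_def)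

lemma tlc_le: "tlc z \<le> z"
  using le_pair(2)[of "psnd (z - 1)" "pfst (z - 1)"] by (simp add: tlc_def)

text \<open>Bit \<open>k\<close> of \<open>m\<close> is set, so \<open>2 ^ k\<close> \<le>
  \<open>m\<close>. Elements of coded sets can therefore be found by bounded search.\<close>

lemma set_decode_less: "k \<in> set_decode m \<Longrightarrow> k < m"
proof -
  assume "k \<in> set_decode m"
  then have "m div 2 ^ k \<noteq> 0" by (auto simp: set_decode_def intro: Nat.gr0I)
  then have "2 ^ k \<le> m" by (metis div_less not_less)
  then show "k < m" using less_exp[of k] by (rule less_le_trans[rotated])
qed

definition edge_table :: "nat \<Rightarrow> nat" where "edge_table m = hdc (tlc (tlc m))"
definition test_table :: "nat \<Rightarrow> nat" where "test_table m = hdc (tlc (tlc (tlc m)))"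

lemma edge_table_less: assumes "pair (pair s s') x \<in> set_decode (edge_table m)"
  shows "s < m \<and> s' < m \<and> x < m"
proof -
  have "pair (pair s s') x < m"
    using set_decode_less[OF assms] hdc_le tlc_le unfolding edge_table_def by (meson less_le_trans order_trans)
  then show ?thesis using le_pair by (meson le_less_trans order_trans)
qed

lemma test_table_less: assumes "pair s y \<in> set_decode (test_table m)"
  shows "y < m"
proof -
  have "pair s y < m"
    using set_decode_less[OF assms] hdc_le tlc_le unfolding test_table_def by (meson less_le_trans order_trans)
  then show ?thesis using le_pair by (meson le_less_trans order_trans)
qed

text \<open>\<open>\<nu>\<close> maps codes of values to values; \<open>x\<close> is the code of the label: an even number for
  \<open>Add\<close>, and then half of it codes an integer, or an odd number for \<open>Eq\<close>.\<close>

definition coded_step :: "nat \<Rightarrow> (nat \<Rightarrow> nat) \<Rightarrow> nat \<Rightarrow> nat \<Rightarrow> nat \<Rightarrow> nat \<Rightarrow> bool" where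
  "coded_step m \<nu> s c s' c' \<longleftrightarrow>
     (\<exists>x<m. pair (pair s s') x \<in> set_decode (edge_table m) \<and>
        (if even x then if even (x div 2) then c' = c + x div 2 div 2 else c' + Suc (x div 2 div 2) = c
         else c' = c \<and> \<nu> (x div 2) = c)) \<and>
     (\<forall>y<m. pair s y \<in> set_decode (test_table m) \<longrightarrow> (\<forall>t<m. t \<in> set_decode y \<longrightarrow> \<nu> t \<noteq> c))"

lemma dec_coded_step [comp_intros]:
  assumes [THEN computable_comp, comp_intros]: "computable m" "computable d" "computable k" "computable s"
    "computable c" "computable s'" "computable c'"
  shows "dec (\<lambda>z. coded_step (m z) (val (d z) (k z)) (s z) (c z) (s' z) (c' z))"
proof -
  have eq: "(if b then P else Q) \<longleftrightarrow> (b \<longrightarrow> P) \<and> (\<not> b \<longrightarrow> Q)" for b P Q by simp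
  show ?thesis
    unfolding coded_step_def eq edge_table_def test_table_def by (intro comp_intros)
qed

text \<open>The absolute weight of an edge is at most the code of its label, and this code is below
  \<open>m\<close>.\<close>

lemma coded_step_bound:
  assumes "coded_step m \<nu> s c s' c'"
  shows "s < m" "s' < m" "c' \<le> c + m" "c \<le> c' + m"
proof -
  obtain x where x: "x < m" "pair (pair s s') x \<in> set_decode (edge_table m)"
    "if even x then if even (x div 2) then c' = c + x div 2 div 2 else c' + Suc (x div 2 div 2) = c
         else c' = c \<and> \<nu> (x div 2) = c"
    using assms unfolding coded_step_def by blast
  show "s < m" "s' < m" using edge_table_less[OF x(2)] by auto
  have "x div 2 div 2 \<le> x" "odd (x div 2) \<Longrightarrow> Suc (x div 2 div 2) \<le> x" by presburger+
  with x(1,3) show "c' \<le> c + m" "c \<le> c' + m" by (auto split: if_splits)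
qed

lemma coded_step_inv:
  assumes "coded_step m \<nu> s c s' c'" "c' + e = e' + c" "\<And>t. t < m \<Longrightarrow> \<nu> t = c \<longleftrightarrow> \<nu>' t = e"
  shows "coded_step m \<nu>' s e s' e'"
proof -
  obtain x where x: "x < m" "pair (pair s s') x \<in> set_decode (edge_table m)"
    "if even x then if even (x div 2) then c' = c + x div 2 div 2 else c' + Suc (x div 2 div 2) = c
         else c' = c \<and> \<nu> (x div 2) = c"
    and t: "\<forall>y<m. pair s y \<in> set_decode (test_table m) \<longrightarrow> (\<forall>t<m. t \<in> set_decode y \<longrightarrow> \<nu> t \<noteq> c)"
    using assms(1) unfolding coded_step_def by blast
  have "if even x then if even (x div 2) then e' = e + x div 2 div 2 else e' + Suc (x div 2 div 2) = e
         else e' = e \<and> \<nu>' (x div 2) = e"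
    using x(1,3) assms(2) assms(3)[of "x div 2"] by (auto split: if_splits)
  moreover have "\<forall>y<m. pair s y \<in> set_decode (test_table m) \<longrightarrow> (\<forall>t<m. t \<in> set_decode y \<longrightarrow> \<nu>' t \<noteq> e)"
    using t assms(3) by blast
  ultimately show ?thesis using x(1,2) unfolding coded_step_def by blast
qed

text \<open>The codes of labels, test sets and tests are smaller than the code of the automaton, so
  the bounds on the quantifiers of \<open>coded_step\<close> lose nothing, and agreement of
  \<open>\<nu>\<close> with \<open>\<mu>\<close> below this code suffices.\<close>

lemma coded_step_eq_iff:
  assumes "wf_oca C" and \<nu>: "\<And>a. \<nu> (2 * a) = a" "\<And>x. Suc (2 * x) < oca_code C \<Longrightarrow> \<nu> (Suc (2 * x)) = \<mu> x"
  shows "coded_step (oca_code C) \<nu> s c s' c' \<longleftrightarrow> valid_transition (subst_oca \<mu> C) (s, int c) (s', int c')"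
proof -
  have fin: "finite (edges C)" "finite (states C)" and sub: "edges C \<subseteq> states C \<times> states C"
    and tests: "\<And>v. v \<in> states C \<Longrightarrow> finite (tests C v)"
    using assms(1) by (auto simp: wf_oca_def intro: finite_subset)
  let ?m = "oca_code C"
  have sv: "subst_val \<mu> t = Const (\<nu> (val_code t))" if "val_code t < ?m" for t
    using \<nu> that by (cases t) (auto simp: sum_encode_def)
  have E: "set_decode (edge_table ?m) = (\<lambda>e. pair (prod_encode e) (op_code (lab C e))) ` edges C"
    using fin by (simp add: edge_table_def oca_code_def pair_def del: list_encode.simps)
  have T: "set_decode (test_table ?m) = (\<lambda>v. pair v (set_encode (val_code ` tests C v))) ` states C"
    using fin by (simp add: test_table_def oca_code_def pair_def del: list_encode.simps)
  have edge: "pair (pair s s') x \<in> set_decode (edge_table ?m) \<longleftrightarrow> (s, s') \<in> edges C \<and> x = op_code (lab C (s, s'))" for x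
    unfolding E by (force simp: pair_def)
  show ?thesis
  proof (cases "(s, s') \<in> edges C")
    case False
    then show ?thesis
      by (simp add: coded_step_def edge valid_transition_def transition_def subst_oca_def)
  next
    case True
    let ?x = "op_code (lab C (s, s'))"
    have x: "?x < ?m" using edge_table_less edge True by blast
    have s: "s \<in> states C" using True sub by auto
    have test: "pair s y \<in> set_decode (test_table ?m) \<longleftrightarrow> y = set_encode (val_code ` tests C s)" for y
      unfolding T using s by auto
    let ?y = "set_encode (val_code ` tests C s)"
    have y: "?y < ?m" using test_table_less test by blast
    have yd: "set_decode ?y = val_code ` tests C s" using tests[OF s] by simp
    have tm: "val_code t < ?m" if "t \<in> tests C s" for t
      using set_decode_less[of "val_code t" ?y] y yd that by auto
    have "(if even ?x then if even (?x div 2) then c' = c + ?x div 2 div 2 else c' + Suc (?x div 2 div 2) = c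
         else c' = c \<and> \<nu> (?x div 2) = c) \<longleftrightarrow>
       int c' - int c = weight (subst_op \<mu> (lab C (s, s'))) \<and>
       (\<forall>a. subst_op \<mu> (lab C (s, s')) = Eq (Const a) \<longrightarrow> int c = int a)"
    proof (cases "lab C (s, s')")
      \<comment> \<open>\<open>int_encode\<close> sends a nonnegative \<open>a\<close> to
        \<open>2 * a\<close> and the negative number \<open>- k - 1\<close> to
        \<open>2 * k + 1\<close>, which matches the inner case distinction.\<close>
      case (Add a)
      then show ?thesis by (auto simp: sum_encode_def int_encode_def)
    next
      case (Eq t)
      with x have "val_code t < ?m" by (simp add: sum_encode_def)
      with Eq show ?thesis by (auto simp: sum_encode_def sv)
    qed
    moreover have "(\<forall>t<?m. t \<in> set_decode ?y \<longrightarrow> \<nu> t \<noteq> c) \<longleftrightarrow>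
        int c \<notin> int ` {a. Const a \<in> subst_val \<mu> ` tests C s}"
      unfolding yd using tm by (auto simp: sv image_iff)
    ultimately show ?thesis
      using x y True
      by (auto simp: coded_step_def edge test valid_transition_def transition_def subst_oca_def)
  qed
qed

lemma config_code_decode:
  assumes "0 \<le> snd p" shows "pfst (config_code p) = fst p" "even (psnd (config_code p))"
    "psnd (config_code p) div 2 = nat (snd p)"
  using assms by (simp_all add: config_code_def pfst_def psnd_def int_encode_def sum_encode_def)

lemma even_psnd_config_code: "even (psnd (config_code p)) \<longleftrightarrow> 0 \<le> snd p"
  by (simp add: config_code_def psnd_def int_encode_def sum_encode_def)

section \<open>Reachability\<close>

lemma valid_transition_configs:
  assumes "wf_oca C" "valid_transition (subst_oca \<mu> C) p q"
  shows "p \<in> configs C" "q \<in> configs C"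
  using assms by (auto simp: wf_oca_def valid_transition_def transition_def subst_oca_def configs_def mem_Times_iff)

text \<open>The conditions on \<open>p\<close> matter for a computation without transitions;
  otherwise its first transition implies them.\<close>

lemma reachable_iff_rtranclp:
  assumes wf: "wf_oca C"
  shows "reachable (subst_oca \<mu> C) p q \<longleftrightarrow>
    p \<in> configs C \<and> 0 \<le> snd p \<and> (valid_transition (subst_oca \<mu> C))\<^sup>*\<^sup>* p q"
    (is "_ \<longleftrightarrow> _ \<and> _ \<and> ?T\<^sup>*\<^sup>* p q")
proof
  have configs: "configs (subst_oca \<mu> C) = configs C" by (simp add: configs_def subst_oca_def)
  {
    assume "reachable (subst_oca \<mu> C) p q"
    then obtain cs where cs: "valid_fin_computation (subst_oca \<mu> C) cs" "hd cs = p" "last cs = q"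
      unfolding reachable_def by blast
    then have ne: "cs \<noteq> []" and st: "\<And>i. Suc i < length cs \<Longrightarrow> ?T (cs ! i) (cs ! Suc i)"
      by (auto simp: valid_fin_computation_def)
    have "?T\<^sup>*\<^sup>* p (cs ! i)" if "i < length cs" for i
      using that
    proof (induction i)
      case 0
      then show ?case using cs(2) ne by (simp add: hd_conv_nth)
    next
      case (Suc i)
      then show ?case using st[of i] by (meson Suc_lessD rtranclp.rtrancl_into_rtrancl)
    qed
    from this[of "length cs - 1"] have "?T\<^sup>*\<^sup>* p q" using cs(3) ne by (simp add: last_conv_nth)
    moreover have "p \<in> configs C"
      using cs hd_in_set[OF ne] by (auto simp: valid_fin_computation_def configs)
    moreover have "0 \<le> snd p"
    proof (cases "length cs = 1")
      case True
      then show ?thesis using cs by (auto simp: valid_fin_computation_def)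
    next
      case False
      with ne have "Suc 0 < length cs" by (cases cs) auto
      from st[OF this] show ?thesis using cs(2) ne by (simp add: hd_conv_nth valid_transition_def)
    qed
    ultimately show "p \<in> configs C \<and> 0 \<le> snd p \<and> ?T\<^sup>*\<^sup>* p q" by blast
  }
  {
    assume p: "p \<in> configs C \<and> 0 \<le> snd p \<and> ?T\<^sup>*\<^sup>* p q"
    then have "?T\<^sup>*\<^sup>* p q" by blast
    then have "\<exists>cs. valid_fin_computation (subst_oca \<mu> C) cs \<and> hd cs = p \<and> last cs = q"
    proof induction
      case base
      show ?case by (rule exI[of _ "[p]"]) (use p in \<open>simp add: valid_fin_computation_def configs\<close>)
    next
      case (step q r)
      then obtain cs where cs: "valid_fin_computation (subst_oca \<mu> C) cs" "hd cs = p" "last cs = q" by blast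
      then have ne: "cs \<noteq> []" by (simp add: valid_fin_computation_def)
      have "?T ((cs @ [r]) ! i) ((cs @ [r]) ! Suc i)" if "Suc i < length (cs @ [r])" for i
      proof (cases "Suc i < length cs")
        case True
        then show ?thesis using cs by (simp add: valid_fin_computation_def nth_append)
      next
        case False
        with that have "i = length cs - 1" "Suc i = length cs" by auto
        then show ?thesis using cs(3) step(2) ne by (simp add: nth_append last_conv_nth)
      qed
      moreover have "r \<in> configs C" using valid_transition_configs[OF wf step(2)] by blast
      ultimately have "valid_fin_computation (subst_oca \<mu> C) (cs @ [r])"
        using cs(1) ne by (auto simp: valid_fin_computation_def configs)
      then show ?case using cs ne by (intro exI[of _ "cs @ [r]"]) simp
    qed
    then show "reachable (subst_oca \<mu> C) p q" by (simp add: reachable_def)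
  }
qed

text \<open>Extends a valuation of parameters to the codes of values, as \<open>coded_step\<close>
  expects; the odd code \<open>Suc (2 * x)\<close> belongs to \<open>Par x\<close>.\<close>

definition ext_val :: "(nat \<Rightarrow> nat) \<Rightarrow> nat \<Rightarrow> nat" where
  "ext_val \<mu> t = (if even t then t div 2 else \<mu> (t div 2))"

definition reach_step :: "nat \<Rightarrow> (nat \<Rightarrow> nat) \<Rightarrow> nat \<times> nat \<Rightarrow> nat \<times> nat \<Rightarrow> bool" where
  "reach_step n \<nu> p q \<longleftrightarrow> coded_step (hdc n) \<nu> (fst p) (snd p) (fst q) (snd q)"

lemma counter_system_reach_step: "counter_system (reach_step n) {..<n} {..<n} n"
proof
  fix \<nu> \<nu>' :: "nat \<Rightarrow> nat" and s c s' c' e e'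
  assume st: "reach_step n \<nu> (s, c) (s', c')"
  then show "s \<in> {..<n} \<and> s' \<in> {..<n} \<and> c' \<le> c + n \<and> c \<le> c' + n"
    using coded_step_bound[of "hdc n" \<nu> s c s' c'] hdc_le[of n] by (auto simp: reach_step_def)
  assume "c' + e = e' + c"
    "\<And>x. x \<in> {..<n} \<Longrightarrow> (\<nu> x = c \<longleftrightarrow> \<nu>' x = e) \<and> (\<nu> x < c \<longleftrightarrow> \<nu>' x < e)"
  then show "reach_step n \<nu>' (s, e) (s', e')"
    using coded_step_inv[of "hdc n" \<nu> s c s' c' e e' \<nu>'] st hdc_le[of n] by (auto simp: reach_step_def)
qed simp_all

lemma rtranclp_coded_step_iff:
  assumes "wf_oca C" "\<And>a. \<nu> (2 * a) = a" "\<And>x. Suc (2 * x) < oca_code C \<Longrightarrow> \<nu> (Suc (2 * x)) = \<mu> x"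
  shows "(\<lambda>p q. coded_step (oca_code C) \<nu> (fst p) (snd p) (fst q) (snd q))\<^sup>*\<^sup>* (s, c) (s', c') \<longleftrightarrow>
    (valid_transition (subst_oca \<mu> C))\<^sup>*\<^sup>* (s, int c) (s', int c')" (is "?R\<^sup>*\<^sup>* _ _ \<longleftrightarrow> ?T\<^sup>*\<^sup>* _ _")
proof
  note iff = coded_step_eq_iff[where \<nu> = \<nu> and \<mu> = \<mu>, OF assms]
  show "?R\<^sup>*\<^sup>* (s, c) (s', c') \<Longrightarrow> ?T\<^sup>*\<^sup>* (s, int c) (s', int c')"
    using rtranclp_map[of ?R "(s, c)" "(s', c')" ?T "\<lambda>(s, c). (s, int c)"] iff by auto
  have "?R (fst p, nat (snd p)) (fst q, nat (snd q))" if "?T p q" for p q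
  proof -
    have "0 \<le> snd p" "0 \<le> snd q" using that by (auto simp: valid_transition_def)
    with that show ?thesis by (simp add: iff)
  qed
  then show "?T\<^sup>*\<^sup>* (s, int c) (s', int c') \<Longrightarrow> ?R\<^sup>*\<^sup>* (s, c) (s', c')"
    using rtranclp_map[of ?T "(s, int c)" "(s', int c')" ?R "\<lambda>p. (fst p, nat (snd p))"] by simp
qed

theorem decidable_reach_problem: "decidable_problem reach_instances reach_code reach_problem"
proof -
  let ?p = "\<lambda>n. hdc (tlc n)" and ?q = "\<lambda>n. hdc (tlc (tlc n))"
  \<comment> \<open>Codes of integers are even exactly for nonnegative integers, so the parity tests
    reject negative counter values and halving recovers the others.\<close>
  define P where "P n \<longleftrightarrow> even (psnd (?p n)) \<and> even (psnd (?q n)) \<and>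
    (\<exists>\<nu>. (\<forall>i. \<nu> (2 * i) = i) \<and> (reach_step n \<nu>)\<^sup>*\<^sup>* (pfst (?p n), psnd (?p n) div 2) (pfst (?q n), psnd (?q n) div 2))" for n
  have "dec P"
    unfolding P_def
  proof (intro comp_intros dec_parameterised_reachability)
    show "counter_system (reach_step n) {..<n} {..<n} n" for n by (rule counter_system_reach_step)
    fix f d m s c s' c'
    assume [comp_intros]: "computable f" "computable d" "computable m" "computable s" "computable c"
      "computable s'" "computable c'"
    show "dec (\<lambda>z. reach_step (f z) (val (d z) (m z)) (s z, c z) (s' z, c' z))"
      unfolding reach_step_def fst_conv snd_conv by (intro comp_intros)
  qed (rule comp_intros)+
  then obtain f where f: "\<And>n. computes f [n] (of_bool (P n))"
    unfolding dec_def computable_def by blast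
  have "P (reach_code i) \<longleftrightarrow> reach_problem i" if "i \<in> reach_instances" for i
  proof -
    obtain C p q where i: "i = (C, p, q)" by (metis prod_cases3)
    let ?n = "reach_code i"
    have n: "hdc ?n = oca_code C" "?p ?n = config_code p" "?q ?n = config_code q"
      by (simp_all add: i reach_code_def del: list_encode.simps)
    have wf: "wf_oca C" and pq: "p \<in> configs C" "q \<in> configs C"
      using that by (auto simp: i reach_instances_def)
    show ?thesis
    proof (cases "0 \<le> snd p \<and> 0 \<le> snd q")
      case False
      \<comment> \<open>A run with a transition ends in a nonnegative value, and a run without
        transitions ends in \<open>p\<close>.\<close>
      have "0 \<le> snd q" if "reachable (subst_oca \<mu> C) p q" for \<mu>
      proof -
        have "(valid_transition (subst_oca \<mu> C))\<^sup>*\<^sup>* p q" "0 \<le> snd p"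
          using that reachable_iff_rtranclp[OF wf] by auto
        then show ?thesis by (cases rule: rtranclp.cases) (auto simp: valid_transition_def)
      qed
      moreover have "0 \<le> snd p" if "reachable (subst_oca \<mu> C) p q" for \<mu>
        using that reachable_iff_rtranclp[OF wf] by auto
      ultimately have "\<not> reach_problem i" using False by (auto simp: i reach_problem_def)
      moreover have "\<not> P ?n" using False by (auto simp: P_def n even_psnd_config_code)
      ultimately show ?thesis by blast
    next
      case True
      then have pq_int: "p = (fst p, int (nat (snd p)))" "q = (fst q, int (nat (snd q)))"
        by (simp_all add: prod_eq_iff)
      have "P ?n \<longleftrightarrow> (\<exists>\<nu>. (\<forall>i. \<nu> (2 * i) = i) \<and>
         (reach_step ?n \<nu>)\<^sup>*\<^sup>* (fst p, nat (snd p)) (fst q, nat (snd q)))"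
        using True by (simp add: P_def n config_code_decode)
      \<comment> \<open>One direction restricts \<open>\<nu>\<close> to the odd codes, the other
        extends \<open>\<mu>\<close> by \<open>ext_val\<close>.\<close>
      also have "\<dots> \<longleftrightarrow> (\<exists>\<mu>. (valid_transition (subst_oca \<mu> C))\<^sup>*\<^sup>* p q)"
      proof
        assume "\<exists>\<nu>. (\<forall>i. \<nu> (2 * i) = i) \<and>
          (reach_step ?n \<nu>)\<^sup>*\<^sup>* (fst p, nat (snd p)) (fst q, nat (snd q))"
        then obtain \<nu> where "\<And>i. \<nu> (2 * i) = i"
          "(reach_step ?n \<nu>)\<^sup>*\<^sup>* (fst p, nat (snd p)) (fst q, nat (snd q))" by blast
        with rtranclp_coded_step_iff[OF wf, of \<nu> "\<lambda>x. \<nu> (Suc (2 * x))"] pq_int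
        show "\<exists>\<mu>. (valid_transition (subst_oca \<mu> C))\<^sup>*\<^sup>* p q"
          by (auto simp: reach_step_def[abs_def] n)
      next
        assume "\<exists>\<mu>. (valid_transition (subst_oca \<mu> C))\<^sup>*\<^sup>* p q"
        then obtain \<mu> where "(valid_transition (subst_oca \<mu> C))\<^sup>*\<^sup>* p q" by blast
        with rtranclp_coded_step_iff[OF wf, of "ext_val \<mu>" \<mu>] pq_int
        have "(reach_step ?n (ext_val \<mu>))\<^sup>*\<^sup>* (fst p, nat (snd p)) (fst q, nat (snd q))"
          by (simp add: reach_step_def[abs_def] n ext_val_def)
        then show "\<exists>\<nu>. (\<forall>i. \<nu> (2 * i) = i) \<and>
          (reach_step ?n \<nu>)\<^sup>*\<^sup>* (fst p, nat (snd p)) (fst q, nat (snd q))"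
          by (intro exI[of _ "ext_val \<mu>"]) (simp add: ext_val_def)
      qed
      also have "\<dots> \<longleftrightarrow> reach_problem i"
        using reachable_iff_rtranclp[OF wf] pq True by (simp add: i reach_problem_def)
      finally show ?thesis .
    qed
  qed
  with f have "computes f [reach_code i] (if reach_problem i then 1 else 0)" if "i \<in> reach_instances" for i
    using that by (metis of_bool_def)
  then show ?thesis unfolding decidable_problem_def by blast
qed

section \<open>Lassos\<close>

definition inf_run :: "('v \<times> nat \<Rightarrow> 'v \<times> nat \<Rightarrow> bool) \<Rightarrow> 'v set set \<Rightarrow> 'v \<times> nat \<Rightarrow> bool" where
  "inf_run T \<F> p \<longleftrightarrow> (\<exists>\<rho>. \<rho> 0 = p \<and> (\<forall>i. T (\<rho> i) (\<rho> (Suc i))) \<and>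
     (\<forall>F\<in>\<F>. \<exists>v\<in>F. \<exists>\<^sub>\<infinity>i. fst (\<rho> i) = v))"

text \<open>The length is positive so that repeating a loop gives an infinite run.\<close>

definition visiting_path :: "('v \<times> nat \<Rightarrow> 'v \<times> nat \<Rightarrow> bool) \<Rightarrow> 'v set set \<Rightarrow> 'v \<times> nat \<Rightarrow> 'v \<times> nat \<Rightarrow> bool" where
  "visiting_path R \<F> a z \<longleftrightarrow> (\<exists>k r. 0 < k \<and> r 0 = a \<and> r k = z \<and> (\<forall>i<k. R (r i) (r (Suc i))) \<and>
     (\<forall>F\<in>\<F>. \<exists>i\<le>k. fst (r i) \<in> F))"

text \<open>A loop can be repeated for one of two reasons: it returns to its first configuration, or
  it gains height while all its sources satisfy \<open>H\<close>, where \<open>H\<close> will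
  guarantee that steps can be shifted upwards.\<close>

definition lasso :: "('v \<times> nat \<Rightarrow> 'v \<times> nat \<Rightarrow> bool) \<Rightarrow> (nat \<Rightarrow> bool) \<Rightarrow> 'v set set \<Rightarrow> 'v \<times> nat \<Rightarrow> bool" where
  "lasso T H \<F> p \<longleftrightarrow> (\<exists>u c c'. T\<^sup>*\<^sup>* p (u, c) \<and>
     (c' = c \<and> visiting_path T \<F> (u, c) (u, c') \<or>
      c < c' \<and> visiting_path (\<lambda>x y. T x y \<and> H (snd x)) \<F> (u, c) (u, c')))"

lemma visiting_path_single: "R a z \<Longrightarrow> visiting_path R {} a z"
  unfolding visiting_path_def
  by (intro exI[of _ 1] exI[of _ "\<lambda>i. if i = 0 then a else z"]) simp

lemma visiting_path_step:
  assumes "visiting_path R \<F> a z" "R z y" shows "visiting_path R \<F> a y"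
proof -
  obtain k r where r: "0 < k" "r 0 = a" "r k = z" "\<forall>i<k. R (r i) (r (Suc i))"
    "\<forall>F\<in>\<F>. \<exists>i\<le>k. fst (r i) \<in> F"
    using assms(1) unfolding visiting_path_def by blast
  have "\<exists>i\<le>Suc k. fst ((r(Suc k := y)) i) \<in> F" if "F \<in> \<F>" for F
  proof -
    obtain i where "i \<le> k" "fst (r i) \<in> F" using r(5) \<open>F \<in> \<F>\<close> by blast
    then show ?thesis by (intro exI[of _ i]) simp
  qed
  then show ?thesis unfolding visiting_path_def
    by (intro exI[of _ "Suc k"] exI[of _ "r(Suc k := y)"]) (use r assms(2) in \<open>auto simp: less_Suc_eq\<close>)
qed

lemma visiting_path_visit:
  assumes "visiting_path R \<F> a z" "fst z \<in> F" shows "visiting_path R (insert F \<F>) a z"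
proof -
  obtain k r where r: "0 < k" "r 0 = a" "r k = z" "\<forall>i<k. R (r i) (r (Suc i))"
    "\<forall>F\<in>\<F>. \<exists>i\<le>k. fst (r i) \<in> F"
    using assms(1) unfolding visiting_path_def by blast
  then show ?thesis unfolding visiting_path_def
    by (intro exI[of _ k] exI[of _ r]) (use assms(2) in auto)
qed

lemma visiting_path_mono:
  assumes "visiting_path R \<F> a z" "\<And>x y. R x y \<Longrightarrow> S x y" shows "visiting_path S \<F> a z"
proof -
  obtain k r where "0 < k" "r 0 = a" "r k = z" "\<forall>i<k. R (r i) (r (Suc i))"
    "\<forall>F\<in>\<F>. \<exists>i\<le>k. fst (r i) \<in> F"
    using assms(1) unfolding visiting_path_def by blast
  then show ?thesis unfolding visiting_path_def
    by (intro exI[of _ k] exI[of _ r]) (use assms(2) in simp)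
qed

lemma inf_run_converse_rtranclp:
  assumes "T\<^sup>*\<^sup>* p q" "inf_run T \<F> q" shows "inf_run T \<F> p"
  using assms
proof (induction rule: converse_rtranclp_induct)
  case (step p q)
  then have "inf_run T \<F> q" by blast
  then obtain \<rho> where \<rho>: "\<rho> 0 = q" "\<forall>i. T (\<rho> i) (\<rho> (Suc i))"
    "\<forall>F\<in>\<F>. \<exists>v\<in>F. \<exists>\<^sub>\<infinity>i. fst (\<rho> i) = v"
    unfolding inf_run_def by (elim exE conjE)
  let ?\<rho> = "\<lambda>i. case i of 0 \<Rightarrow> p | Suc i \<Rightarrow> \<rho> i"
  have step': "T (?\<rho> i) (?\<rho> (Suc i))" for i using step(1) \<rho> by (cases i) auto
  have visit: "\<exists>\<^sub>\<infinity>i. fst (?\<rho> i) = v" if "\<exists>\<^sub>\<infinity>i. fst (\<rho> i) = v" for v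
    unfolding INFM_nat
  proof
    fix m
    obtain i where "m < i" "fst (\<rho> i) = v" using \<open>\<exists>\<^sub>\<infinity>i. fst (\<rho> i) = v\<close> unfolding INFM_nat by blast
    then show "\<exists>i>m. fst (?\<rho> i) = v" by (intro exI[of _ "Suc i"]) simp
  qed
  have "\<exists>v\<in>F. \<exists>\<^sub>\<infinity>i. fst (?\<rho> i) = v" if "F \<in> \<F>" for F
  proof -
    from \<rho>(3) that have "\<exists>v\<in>F. \<exists>\<^sub>\<infinity>i. fst (\<rho> i) = v" by (rule bspec)
    then obtain v where "v \<in> F" "\<exists>\<^sub>\<infinity>i. fst (\<rho> i) = v" by (rule bexE)
    from visit[OF this(2)] this(1) show ?thesis by (rule bexI)
  qed
  moreover have "?\<rho> 0 = p" by simp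
  ultimately show ?case
    unfolding inf_run_def using step' by (intro exI[of _ ?\<rho>] conjI allI ballI)
qed

text \<open>Round \<open>j\<close> is the original loop raised by \<open>j * d\<close>, where
  \<open>d\<close> is the gain of one round; \<open>d = 0\<close> if the loop is closed.\<close>

lemma lasso_imp_inf_run:
  assumes shift: "\<And>s c s' c' d. T (s, c) (s', c') \<Longrightarrow> H c \<Longrightarrow> T (s, c + d) (s', c' + d)"
    and "lasso T H \<F> p"
  shows "inf_run T \<F> p"
proof -
  obtain u c c' where p: "T\<^sup>*\<^sup>* p (u, c)" and
    cc': "c' = c \<and> visiting_path T \<F> (u, c) (u, c') \<or>
      c < c' \<and> visiting_path (\<lambda>x y. T x y \<and> H (snd x)) \<F> (u, c) (u, c')"
    using assms(2) unfolding lasso_def by blast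
  define d where "d = c' - c"
  have c': "c' = c + d" using cc' by (auto simp: d_def)
  have "\<exists>R. visiting_path R \<F> (u, c) (u, c') \<and>
      (\<forall>x y j. R x y \<longrightarrow> T (fst x, snd x + j * d) (fst y, snd y + j * d))"
  proof (cases "c' = c")
    case True
    with cc' show ?thesis by (intro exI[of _ T]) (simp add: d_def)
  next
    case False
    with cc' show ?thesis by (intro exI[of _ "\<lambda>x y. T x y \<and> H (snd x)"]) (auto intro: shift)
  qed
  then obtain R where "visiting_path R \<F> (u, c) (u, c')"
    and R: "\<And>x y j. R x y \<Longrightarrow> T (fst x, snd x + j * d) (fst y, snd y + j * d)" by blast
  then obtain k r where r: "0 < k" "r 0 = (u, c)" "r k = (u, c')" "\<forall>i<k. R (r i) (r (Suc i))"
    "\<forall>F\<in>\<F>. \<exists>i\<le>k. fst (r i) \<in> F"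
    unfolding visiting_path_def by blast
  define \<rho> where "\<rho> t = (fst (r (t mod k)), snd (r (t mod k)) + t div k * d)" for t
  have "T (\<rho> t) (\<rho> (Suc t))" for t
  proof -
    have t: "R (r (t mod k)) (r (Suc (t mod k)))" using r by simp
    show ?thesis
    proof (cases "Suc (t mod k) = k")
      case False
      then have "Suc t mod k = Suc (t mod k)" "Suc t div k = t div k"
        by (simp_all add: mod_Suc div_Suc)
      with R[OF t, of "t div k"] show ?thesis by (simp add: \<rho>_def)
    next
      \<comment> \<open>At the seam, the end \<open>r k\<close> of one round is \<open>r 0\<close>
        raised by \<open>d\<close>, which is the start of the next round.\<close>
      case True
      then have "Suc t mod k = 0" "Suc t div k = Suc (t div k)"
        by (simp_all add: mod_Suc div_Suc)
      with R[OF t, of "t div k"] True r show ?thesis by (simp add: \<rho>_def c' algebra_simps)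
    qed
  qed
  moreover have "\<exists>v\<in>F. \<exists>\<^sub>\<infinity>i. fst (\<rho> i) = v" if "F \<in> \<F>" for F
  proof -
    obtain i where i: "i \<le> k" "fst (r i) \<in> F" using r(5) \<open>F \<in> \<F>\<close> by blast
    \<comment> \<open>Positions within a round are below \<open>k\<close>; the index
      \<open>k\<close> is replaced by 0, which has the same state \<open>u\<close>.\<close>
    obtain i' where i': "i' < k" "fst (r i') = fst (r i)"
    proof (cases "i = k")
      case True
      with r that[of 0] show ?thesis by simp
    next
      case False
      with i that[of i] show ?thesis by simp
    qed
    have "\<exists>\<^sub>\<infinity>j. fst (\<rho> j) = fst (r i)"
      unfolding INFM_nat
    proof
      fix m
      have "m < i' + k * Suc m" using r(1) by (cases k) auto
      moreover have "fst (\<rho> (i' + k * Suc m)) = fst (r i)" using i' by (simp add: \<rho>_def del: mult_Suc_right)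
      ultimately show "\<exists>j>m. fst (\<rho> j) = fst (r i)" by blast
    qed
    with i show ?thesis by blast
  qed
  moreover have "\<rho> 0 = (u, c)" by (simp add: \<rho>_def r)
  ultimately have "inf_run T \<F> (u, c)" unfolding inf_run_def by blast
  with p show ?thesis by (rule inf_run_converse_rtranclp)
qed

text \<open>Either some counter value recurs, and then so does some configuration, or the counter tends
  to infinity.\<close>

lemma inf_run_anchor:
  fixes \<rho> :: "nat \<Rightarrow> 'v \<times> nat"
  assumes "finite Q" "\<And>i. fst (\<rho> i) \<in> Q"
  obtains t0 b where "b \<Longrightarrow> \<forall>t\<ge>t0. K < snd (\<rho> t)"
    and "\<And>t. \<exists>t1\<ge>t. fst (\<rho> t1) = fst (\<rho> t0) \<and> (snd (\<rho> t1) = snd (\<rho> t0) \<or> b \<and> snd (\<rho> t0) < snd (\<rho> t1))"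
proof (cases "\<exists>B. \<exists>\<^sub>\<infinity>t. snd (\<rho> t) \<le> B")
  case True
  then obtain B where B: "infinite {t. snd (\<rho> t) \<le> B}" by (auto simp: INFM_iff_infinite)
  have "\<rho> ` {t. snd (\<rho> t) \<le> B} \<subseteq> Q \<times> {..B}"
    by (rule image_subsetI) (use assms in \<open>simp add: mem_Times_iff\<close>)
  then have "finite (\<rho> ` {t. snd (\<rho> t) \<le> B})" using assms(1) finite_subset by blast
  from pigeonhole_infinite[OF B this] obtain t0 where
    "infinite {t \<in> {t. snd (\<rho> t) \<le> B}. \<rho> t = \<rho> t0}" by blast
  then have "\<exists>t1\<ge>t. \<rho> t1 = \<rho> t0" for t
    by (auto simp: infinite_nat_iff_unbounded_le)
  then show ?thesis using that[of False t0] by metis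
next
  case False
  then have large: "\<exists>m. \<forall>t>m. B < snd (\<rho> t)" for B
    by (auto simp: INFM_nat not_le) 
  then obtain m where m: "\<And>t. t > m \<Longrightarrow> K < snd (\<rho> t)" by blast
  have inf: "infinite {t. t > m}" by (simp add: infinite_Ioi flip: greaterThan_def)
  have "finite ((fst \<circ> \<rho>) ` {t. t > m})"
    by (rule finite_subset[OF image_subsetI assms(1)]) (simp add: assms(2))
  \<comment> \<open>The repeated state is sought after time \<open>m\<close>, so the counter exceeds
    \<open>K\<close> from \<open>t0\<close> on.\<close>
  from pigeonhole_infinite[OF inf this] obtain t0 where t0: "t0 > m" and
    i: "infinite {t \<in> {t. t > m}. (fst \<circ> \<rho>) t = (fst \<circ> \<rho>) t0}" by blast
  have "\<exists>t1\<ge>t. fst (\<rho> t1) = fst (\<rho> t0) \<and> snd (\<rho> t0) < snd (\<rho> t1)" for t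
  proof -
    obtain m' where m': "\<And>t. t > m' \<Longrightarrow> snd (\<rho> t0) < snd (\<rho> t)" using large by blast
    obtain t1 where "t1 \<ge> max t (Suc m')" "fst (\<rho> t1) = fst (\<rho> t0)"
      using i unfolding infinite_nat_iff_unbounded_le comp_def mem_Collect_eq by blast
    then show ?thesis using m'[of t1] by auto
  qed
  then show ?thesis using that[of True t0] m t0 by (meson less_le_trans)
qed

section \<open>A counter system that guesses a lasso\<close>

definition loop_state :: "nat \<Rightarrow> nat \<Rightarrow> nat \<Rightarrow> nat \<Rightarrow> nat" where
  "loop_state b u v l = pair (Suc b) (pair u (pair v l))"

text \<open>The codes below \<open>n\<close> include those of all tests and equality labels of the
  automaton, because its code \<open>hdc n\<close> is at most \<open>n\<close>.\<close>

definition above_tests :: "nat \<Rightarrow> (nat \<Rightarrow> nat) \<Rightarrow> nat \<Rightarrow> bool" where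
  "above_tests n \<nu> c \<longleftrightarrow> (\<forall>t<n. \<nu> t < c)"

text \<open>The number is odd, hence not the code of a constant, and at least \<open>n\<close>, so
  its value can be chosen without affecting the steps of the automaton.\<close>

abbreviation anchor :: "nat \<Rightarrow> nat" where "anchor n \<equiv> Suc (2 * n)"

text \<open>The run guesses the lasso. States \<open>pair 0 v\<close> belong to its stem. In \<open>loop_state b u v l\<close> the
  loop started at state \<open>u\<close> with the counter value of the additional parameter \<open>anchor n\<close>, it is now
  at \<open>v\<close>, and \<open>l\<close> codes the list of sets still to be visited; if \<open>b = 1\<close>, then the loop stays above
  all tests and may end with a larger counter value. From \<open>pair 3 0\<close> the counter is emptied.\<close>

definition rep_step :: "nat \<Rightarrow> (nat \<Rightarrow> nat) \<Rightarrow> nat \<times> nat \<Rightarrow> nat \<times> nat \<Rightarrow> bool" where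
  "rep_step n \<nu> = (\<lambda>(s, c) (s', c').
     (\<exists>v<n. \<exists>v'<n. s = pair 0 v \<and> s' = pair 0 v' \<and> coded_step (hdc n) \<nu> v c v' c') \<or>
     (\<exists>v<n. \<exists>v'<n. \<exists>b<2. s = pair 0 v \<and> s' = loop_state b v v' (hdc (tlc n)) \<and>
        coded_step (hdc n) \<nu> v c v' c' \<and> \<nu> (anchor n) = c \<and> (b = 1 \<longrightarrow> above_tests n \<nu> c)) \<or>
     (\<exists>u<n. \<exists>v<n. \<exists>v'<n. \<exists>l<Suc n. \<exists>b<2. s = loop_state b u v l \<and> s' = loop_state b u v' l \<and>
        coded_step (hdc n) \<nu> v c v' c' \<and> (b = 1 \<longrightarrow> above_tests n \<nu> c)) \<or>
     (\<exists>u<n. \<exists>v<n. \<exists>l<Suc n. \<exists>b<2. s = loop_state b u v l \<and> s' = loop_state b u v (tlc l) \<and>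
        0 < l \<and> v \<in> set_decode (hdc l) \<and> c' = c) \<or>
     (\<exists>u<n. \<exists>b<2. s = loop_state b u u 0 \<and> s' = pair 3 0 \<and> c' = c \<and>
        (\<nu> (anchor n) = c \<or> b = 1 \<and> \<nu> (anchor n) < c)) \<or>
     s = pair 3 0 \<and> s' = pair 3 0 \<and> c = Suc c')"

lemma dec_rep_step:
  assumes [THEN computable_comp, comp_intros]: "computable n" "computable d" "computable k" "computable s"
    "computable c" "computable s'" "computable c'"
  shows "dec (\<lambda>z. rep_step (n z) (val (d z) (k z)) (s z, c z) (s' z, c' z))"
  unfolding rep_step_def prod.case loop_state_def above_tests_def by (intro comp_intros)

lemma counter_system_rep_step:
  "counter_system (rep_step n) {..<Suc (pair 3 (pair n (pair n n)))} {..<Suc (anchor n)} (Suc n)"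
proof
  fix \<nu> \<nu>' :: "nat \<Rightarrow> nat" and s c s' c' e e'
  assume st: "rep_step n \<nu> (s, c) (s', c')"
  have "pair 0 v < Suc (pair 3 (pair n (pair n n)))" if "v < n" for v
    using that le_pair(1)[of n "pair n n"] by (intro le_imp_less_Suc pair_mono) auto
  moreover have "loop_state b u v l < Suc (pair 3 (pair n (pair n n)))"
    if "b < 2" "u < n" "v < n" "l \<le> n" for b u v l
    unfolding loop_state_def using that by (intro le_imp_less_Suc pair_mono) auto
  moreover have "pair 3 0 < Suc (pair 3 (pair n (pair n n)))"
    by (intro le_imp_less_Suc pair_mono) auto
  moreover have "hdc (tlc n) \<le> n" "\<And>l. l \<le> n \<Longrightarrow> tlc l \<le> n"
    using hdc_le tlc_le order_trans by blast+
  ultimately have "s \<in> {..<Suc (pair 3 (pair n (pair n n)))} \<and> s' \<in> {..<Suc (pair 3 (pair n (pair n n)))}"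
    using st unfolding rep_step_def prod.case less_Suc_eq_le[of _ n] lessThan_iff
    by (elim disjE exE conjE) simp_all
  moreover have "c' \<le> c + Suc n \<and> c \<le> c' + Suc n" if "coded_step (hdc n) \<nu> v c v' c'" for v v'
    using coded_step_bound(3,4)[OF that] hdc_le[of n] by linarith
  \<comment> \<open>The width \<open>Suc n\<close> also covers the emptying step, which changes the
    counter by 1, when \<open>n = 0\<close>.\<close>
  then have "c' \<le> c + Suc n \<and> c \<le> c' + Suc n"
    using st unfolding rep_step_def prod.case
    by (elim disjE exE conjE) (blast | simp)+
  ultimately show "s \<in> {..<Suc (pair 3 (pair n (pair n n)))} \<and> s' \<in> {..<Suc (pair 3 (pair n (pair n n)))} \<and>
      c' \<le> c + Suc n \<and> c \<le> c' + Suc n" by blast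
  assume ce: "c' + e = e' + c"
    and \<nu>: "\<And>x. x \<in> {..<Suc (anchor n)} \<Longrightarrow> (\<nu> x = c \<longleftrightarrow> \<nu>' x = e) \<and> (\<nu> x < c \<longleftrightarrow> \<nu>' x < e)"
  \<comment> \<open>Invariance is proved as an equivalence of all atoms, so that the definition of
    \<open>rep_step\<close> for \<open>\<nu>\<close> is rewritten into the one for
    \<open>\<nu>'\<close>.\<close>
  have "coded_step (hdc n) \<nu> v c v' c' \<longleftrightarrow> coded_step (hdc n) \<nu>' v e v' e'" for v v'
    using coded_step_inv[of "hdc n" \<nu> v c v' c' e e' \<nu>'] coded_step_inv[of "hdc n" \<nu>' v e v' e' c c' \<nu>]
      ce \<nu> hdc_le[of n] by auto
  moreover have "above_tests n \<nu> c \<longleftrightarrow> above_tests n \<nu>' e"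
    using \<nu> by (auto simp: above_tests_def)
  moreover have "\<nu> (anchor n) = c \<longleftrightarrow> \<nu>' (anchor n) = e" "\<nu> (anchor n) < c \<longleftrightarrow> \<nu>' (anchor n) < e"
    using \<nu> by simp_all
  moreover have "c' = c \<longleftrightarrow> e' = e" "c = Suc c' \<longleftrightarrow> e = Suc e'" using ce by auto
  ultimately have "rep_step n \<nu> (s, c) (s', c') \<longleftrightarrow> rep_step n \<nu>' (s, e) (s', e')"
    unfolding rep_step_def prod.case by (simp only:)
  with st show "rep_step n \<nu>' (s, e) (s', e')" by blast
qed simp_all

lemma pair_eq_loop_state [simp]:
  "pair 0 v \<noteq> loop_state b u v' l" "loop_state b u v' l \<noteq> pair 0 v"
  "loop_state b u v l = loop_state b' u' v' l' \<longleftrightarrow> b = b' \<and> u = u' \<and> v = v' \<and> l = l'"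
  "b < 2 \<Longrightarrow> loop_state b u v l \<noteq> pair 3 0" "b < 2 \<Longrightarrow> pair 3 0 \<noteq> loop_state b u v l"
  by (auto simp: loop_state_def)

lemma rep_step_cases:
  assumes "rep_step n \<nu> p q"
  obtains (stem) v v' where "fst p = pair 0 v" "fst q = pair 0 v'" "reach_step n \<nu> (v, snd p) (v', snd q)"
  | (enter) v v' b where "b < 2" "fst p = pair 0 v" "fst q = loop_state b v v' (hdc (tlc n))"
      "reach_step n \<nu> (v, snd p) (v', snd q)" "\<nu> (anchor n) = snd p" "b = 1 \<longrightarrow> above_tests n \<nu> (snd p)"
  | (loop) u v v' l b where "b < 2" "fst p = loop_state b u v l" "fst q = loop_state b u v' l"
      "reach_step n \<nu> (v, snd p) (v', snd q)" "b = 1 \<longrightarrow> above_tests n \<nu> (snd p)"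
  | (visit) u v l b where "b < 2" "fst p = loop_state b u v l" "fst q = loop_state b u v (tlc l)"
      "0 < l" "v \<in> set_decode (hdc l)" "snd q = snd p"
  | (leave) u b where "b < 2" "fst p = loop_state b u u 0" "fst q = pair 3 0" "snd q = snd p"
      "\<nu> (anchor n) = snd p \<or> b = 1 \<and> \<nu> (anchor n) < snd p"
  | (empty) "fst p = pair 3 0" "fst q = pair 3 0" "snd p = Suc (snd q)"
  using assms unfolding rep_step_def reach_step_def case_prod_beta fst_conv snd_conv
  by (elim disjE exE conjE) blast+

text \<open>Induction along the run with one invariant per phase: the stem is a run of the
  automaton, the loop satisfies \<open>loop_inv\<close>, and the final state certifies a
  lasso.\<close>

lemma rep_step_imp_lasso:
  assumes L: "hdc (tlc n) = list_encode (map set_encode Fs)" and fin: "\<And>F. F \<in> set Fs \<Longrightarrow> finite F"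
    and run: "(rep_step n \<nu>)\<^sup>*\<^sup>* (pair 0 v0, c0) (pair 3 0, 0)"
  shows "lasso (reach_step n \<nu>) (above_tests n \<nu>) (set Fs) (v0, c0)"
proof -
  let ?T = "reach_step n \<nu>" and ?H = "above_tests n \<nu>" and ?y = "\<nu> (anchor n)"
  let ?vp = "\<lambda>b. visiting_path (\<lambda>x y. ?T x y \<and> (b = (1::nat) \<longrightarrow> ?H (snd x)))"
  \<comment> \<open>\<open>Fd\<close> lists the sets already visited, and \<open>Fr\<close>, coded
    by \<open>l\<close>, those still to come. The path is never empty, since entering the loop takes
    a transition.\<close>
  define loop_inv where "loop_inv b u v l c \<longleftrightarrow>
    (\<exists>Fd Fr. l = list_encode (map set_encode Fr) \<and> Fs = Fd @ Fr \<and> ?T\<^sup>*\<^sup>* (v0, c0) (u, ?y) \<and>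
      ?vp b (set Fd) (u, ?y) (v, c))" for b u v l c
  have "(\<forall>v. fst q = pair 0 v \<longrightarrow> ?T\<^sup>*\<^sup>* (v0, c0) (v, snd q)) \<and>
    (\<forall>b<2. \<forall>u v l. fst q = loop_state b u v l \<longrightarrow> loop_inv b u v l (snd q)) \<and>
    (fst q = pair 3 0 \<longrightarrow> lasso ?T ?H (set Fs) (v0, c0))"
    if "(rep_step n \<nu>)\<^sup>*\<^sup>* (pair 0 v0, c0) q" for q
    using that
  proof induction
    case base
    then show ?case by simp
  next
    case (step p q)
    from step(2) show ?case
    proof (cases rule: rep_step_cases)
      case (stem v v')
      with step.IH have "?T\<^sup>*\<^sup>* (v0, c0) (v, snd p)" by blast
      with stem have "?T\<^sup>*\<^sup>* (v0, c0) (v', snd q)" by (meson rtranclp.rtrancl_into_rtrancl)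
      with stem show ?thesis by simp
    next
      case (enter v v' b)
      with step.IH have "?T\<^sup>*\<^sup>* (v0, c0) (v, snd p)" by blast
      moreover have "?vp b (set []) (v, snd p) (v', snd q)"
        unfolding set_empty2[symmetric] using enter by (auto intro: visiting_path_single)
      ultimately have "loop_inv b v v' (hdc (tlc n)) (snd q)"
        unfolding loop_inv_def L enter(5) by (intro exI[of _ "[]"] exI[of _ Fs]) simp
      with enter show ?thesis by simp
    next
      case (loop u v v' l b)
      with step.IH have "loop_inv b u v l (snd p)" by blast
      then obtain Fd Fr where *: "l = list_encode (map set_encode Fr)" "Fs = Fd @ Fr"
        "?T\<^sup>*\<^sup>* (v0, c0) (u, ?y)" "?vp b (set Fd) (u, ?y) (v, snd p)"
        unfolding loop_inv_def by blast
      have "?vp b (set Fd) (u, ?y) (v', snd q)"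
        by (rule visiting_path_step[OF *(4)]) (use loop in simp)
      with * have "loop_inv b u v' l (snd q)" unfolding loop_inv_def by blast
      with loop show ?thesis by simp
    next
      case (visit u v l b)
      with step.IH have "loop_inv b u v l (snd p)" by blast
      then obtain Fd Fr where *: "l = list_encode (map set_encode Fr)" "Fs = Fd @ Fr"
        "?T\<^sup>*\<^sup>* (v0, c0) (u, ?y)" "?vp b (set Fd) (u, ?y) (v, snd p)"
        unfolding loop_inv_def by blast
      obtain F Fr' where Fr: "Fr = F # Fr'" using visit(4) * by (cases Fr) auto
      have "v \<in> F" using visit(5) * Fr fin[of F] by (simp del: list_encode.simps)
      with *(4) have "?vp b (insert F (set Fd)) (u, ?y) (v, snd p)"
        by (intro visiting_path_visit) simp_all
      with * Fr have "loop_inv b u v (tlc l) (snd q)"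
        unfolding loop_inv_def visit(6) by (intro exI[of _ "Fd @ [F]"] exI[of _ Fr']) (simp del: list_encode.simps)
      with visit show ?thesis by simp
    next
      case (leave u b)
      with step.IH have "loop_inv b u u 0 (snd p)" by blast
      then obtain Fd Fr where *: "0 = list_encode (map set_encode Fr)" "Fs = Fd @ Fr"
        "?T\<^sup>*\<^sup>* (v0, c0) (u, ?y)" "?vp b (set Fd) (u, ?y) (u, snd p)"
        unfolding loop_inv_def by blast
      then have Fs: "Fs = Fd" by (cases Fr) auto
      have "lasso ?T ?H (set Fs) (v0, c0)"
      \<comment> \<open>A loop with \<open>b = 1\<close> may also end at its initial value, so the
        counter and not \<open>b\<close> decides which kind of lasso it is.\<close>
      proof (cases "?y = snd p")
        case True
        have "visiting_path ?T (set Fs) (u, ?y) (u, snd p)"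
          by (rule visiting_path_mono[OF *(4)[folded Fs]]) simp
        with True *(3) show ?thesis unfolding lasso_def
          by - (rule exI[of _ u], rule exI[of _ ?y], rule exI[of _ "snd p"], simp)
      next
        case False
        with leave have "b = 1" "?y < snd p" by auto
        moreover from this have "visiting_path (\<lambda>x y. ?T x y \<and> ?H (snd x)) (set Fs) (u, ?y) (u, snd p)"
          using *(4) Fs by simp
        ultimately show ?thesis using *(3) unfolding lasso_def
          by - (rule exI[of _ u], rule exI[of _ ?y], rule exI[of _ "snd p"], simp)
      qed
      with leave show ?thesis by (simp add: loop_state_def)
    next
      case empty
      with step.IH show ?thesis by simp
    qed
  qed
  from this[OF run] show ?thesis by simp
qed

lemma rep_step_stem:
  "\<lbrakk>v < n; v' < n; reach_step n \<nu> (v, c) (v', c')\<rbrakk> \<Longrightarrow> rep_step n \<nu> (pair 0 v, c) (pair 0 v', c')"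
  by (simp add: rep_step_def reach_step_def less_Suc_eq_le)

lemma rep_step_enter:
  "\<lbrakk>v < n; v' < n; b < 2; reach_step n \<nu> (v, c) (v', c'); \<nu> (anchor n) = c; b = 1 \<longrightarrow> above_tests n \<nu> c\<rbrakk>
    \<Longrightarrow> rep_step n \<nu> (pair 0 v, c) (loop_state b v v' (hdc (tlc n)), c')"
  by (simp add: rep_step_def reach_step_def less_Suc_eq_le)

lemma rep_step_loop:
  "\<lbrakk>u < n; v < n; v' < n; l \<le> n; b < 2; reach_step n \<nu> (v, c) (v', c'); b = 1 \<longrightarrow> above_tests n \<nu> c\<rbrakk>
    \<Longrightarrow> rep_step n \<nu> (loop_state b u v l, c) (loop_state b u v' l, c')"
  by (simp add: rep_step_def reach_step_def less_Suc_eq_le)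

lemma rep_step_visit:
  "\<lbrakk>u < n; v < n; l \<le> n; b < 2; 0 < l; v \<in> set_decode (hdc l)\<rbrakk>
    \<Longrightarrow> rep_step n \<nu> (loop_state b u v l, c) (loop_state b u v (tlc l), c)"
  by (simp add: rep_step_def reach_step_def less_Suc_eq_le)

lemma rep_step_leave:
  "\<lbrakk>v < n; b < 2; \<nu> (anchor n) = c \<or> b = 1 \<and> \<nu> (anchor n) < c\<rbrakk>
    \<Longrightarrow> rep_step n \<nu> (loop_state b v v 0, c) (pair 3 0, c)"
  by (simp add: rep_step_def reach_step_def less_Suc_eq_le)

text \<open>Emptying gives all successful runs the same last configuration, whatever the counter
  value at the end of the loop.\<close>

lemma rep_step_empty: "(rep_step n \<nu>)\<^sup>*\<^sup>* (pair 3 0, c) (pair 3 0, 0)"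
proof (induction c)
  case (Suc c)
  have "rep_step n \<nu> (pair 3 0, Suc c) (pair 3 0, c)" by (simp add: rep_step_def)
  then show ?case using Suc by (rule converse_rtranclp_into_rtranclp)
qed simp

text \<open>The run is followed up to \<open>t0\<close>, whose counter value becomes the additional
  parameter, then through the sets of \<open>Fs\<close> in the order of the list, and on to a time
  at which the state at \<open>t0\<close> recurs with a suitable counter value.\<close>

lemma inf_run_imp_rep_step:
  assumes L: "hdc (tlc n) = list_encode (map set_encode Fs)" and fin: "\<And>F. F \<in> set Fs \<Longrightarrow> finite F"
    and run: "inf_run (reach_step n \<nu>) (set Fs) (v0, c0)"
  shows "\<exists>y. (rep_step n (\<nu>(anchor n := y)))\<^sup>*\<^sup>* (pair 0 v0, c0) (pair 3 0, 0)"
proof -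
  obtain \<rho> where \<rho>0: "\<rho> 0 = (v0, c0)" and \<rho>: "\<forall>i. reach_step n \<nu> (\<rho> i) (\<rho> (Suc i))"
    and visits: "\<forall>F\<in>set Fs. \<exists>v\<in>F. \<exists>\<^sub>\<infinity>i. fst (\<rho> i) = v"
    using run unfolding inf_run_def by (elim exE conjE)
  have \<rho>n: "fst (\<rho> i) \<in> {..<n}" for i
    using spec[OF \<rho>, of i] coded_step_bound(1) hdc_le[of n] unfolding reach_step_def by fastforce
  \<comment> \<open>The threshold is the sum of the values of all codes below \<open>n\<close>,
    hence at least each of them.\<close>
  obtain t0 b where hi: "b \<Longrightarrow> \<forall>t\<ge>t0. (\<Sum>i<n. \<nu> i) < snd (\<rho> t)"
    and recur: "\<And>t. \<exists>t1\<ge>t. fst (\<rho> t1) = fst (\<rho> t0) \<and>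
       (snd (\<rho> t1) = snd (\<rho> t0) \<or> b \<and> snd (\<rho> t0) < snd (\<rho> t1))"
    using inf_run_anchor[of "{..<n}" \<rho>] \<rho>n by (metis finite_lessThan)
  define \<mu> where "\<mu> = \<nu>(anchor n := snd (\<rho> t0))"
  let ?R = "(rep_step n \<mu>)\<^sup>*\<^sup>*" and ?b = "of_bool b :: nat" and ?u = "fst (\<rho> t0)"
  have \<mu>: "\<mu> t = \<nu> t" if "t < n" for t using that by (simp add: \<mu>_def)
  have st: "reach_step n \<mu> (fst (\<rho> i), snd (\<rho> i)) (fst (\<rho> (Suc i)), snd (\<rho> (Suc i)))" for i
  proof -
    have "coded_step (hdc n) \<nu> (fst (\<rho> i)) (snd (\<rho> i)) (fst (\<rho> (Suc i))) (snd (\<rho> (Suc i)))"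
      using \<rho> by (simp add: reach_step_def)
    then have "coded_step (hdc n) \<mu> (fst (\<rho> i)) (snd (\<rho> i)) (fst (\<rho> (Suc i))) (snd (\<rho> (Suc i)))"
      by (rule coded_step_inv) (use \<mu> hdc_le[of n] in auto)
    then show ?thesis by (simp add: reach_step_def)
  qed
  have b2: "?b < 2" by simp
  have n: "fst (\<rho> i) < n" for i using \<rho>n by simp
  have above: "?b = 1 \<longrightarrow> above_tests n \<mu> (snd (\<rho> t))" if "t0 \<le> t" for t
  proof
    assume "?b = 1"
    then have b by (cases b) simp_all
    with hi that have "(\<Sum>i<n. \<nu> i) < snd (\<rho> t)" by simp
    moreover have "\<nu> i \<le> (\<Sum>i<n. \<nu> i)" if "i < n" for i
      using that by (intro member_le_sum) auto
    ultimately show "above_tests n \<mu> (snd (\<rho> t))"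
      unfolding above_tests_def using \<mu> by (metis le_less_trans)
  qed
  have stem: "?R (pair 0 v0, c0) (pair 0 (fst (\<rho> t)), snd (\<rho> t))" for t
  proof (induction t)
    case (Suc t)
    then show ?case using rep_step_stem[OF n n st] by (rule rtranclp.rtrancl_into_rtrancl)
  qed (simp add: \<rho>0)
  have forward: "?R (loop_state ?b ?u (fst (\<rho> t)) l, snd (\<rho> t)) (loop_state ?b ?u (fst (\<rho> t')) l, snd (\<rho> t'))"
    if "t0 \<le> t" "t \<le> t'" "l \<le> n" for t t' l
    using that(2)
  proof (induction t' rule: dec_induct)
    case (step t')
    have "t0 \<le> t'" using that step by simp
    from step(3) rep_step_loop[OF n n n that(3) b2 st above[OF this]]
    show ?case by (rule rtranclp.rtrancl_into_rtrancl)
  qed simp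
  \<comment> \<open>Every set of the list is visited infinitely often, so the list can be worked off
    starting at any time from \<open>t0\<close> on.\<close>
  have consume: "\<exists>t'\<ge>t. ?R (loop_state ?b ?u (fst (\<rho> t)) (list_encode (map set_encode Fr)), snd (\<rho> t))
      (loop_state ?b ?u (fst (\<rho> t')) 0, snd (\<rho> t'))"
    if "t0 \<le> t" "list_encode (map set_encode Fr) \<le> n" "set Fr \<subseteq> set Fs" for t Fr
    using that
  proof (induction Fr arbitrary: t)
    case Nil
    then show ?case by auto
  next
    case (Cons F Fr)
    let ?l = "list_encode (map set_encode (F # Fr))"
    have "F \<in> set Fs" using Cons.prems by simp
    with visits have "\<exists>v\<in>F. \<exists>\<^sub>\<infinity>i. fst (\<rho> i) = v" by (rule bspec)
    then obtain v where v: "v \<in> F" "\<exists>\<^sub>\<infinity>i. fst (\<rho> i) = v" by (rule bexE)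
    then obtain i where i: "t < i" "fst (\<rho> i) \<in> F" unfolding INFM_nat by blast
    have tl: "tlc ?l = list_encode (map set_encode Fr)" and hd: "set_decode (hdc ?l) = F"
      using fin[OF \<open>F \<in> set Fs\<close>] by (simp_all del: list_encode.simps)
    have "?R (loop_state ?b ?u (fst (\<rho> t)) ?l, snd (\<rho> t)) (loop_state ?b ?u (fst (\<rho> i)) ?l, snd (\<rho> i))"
      using forward Cons.prems i by simp
    also have "rep_step n \<mu> (loop_state ?b ?u (fst (\<rho> i)) ?l, snd (\<rho> i))
        (loop_state ?b ?u (fst (\<rho> i)) (tlc ?l), snd (\<rho> i))"
      by (rule rep_step_visit[OF n n Cons.prems(2) b2]) (use hd i in auto)
    finally have 1: "?R (loop_state ?b ?u (fst (\<rho> t)) ?l, snd (\<rho> t))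
        (loop_state ?b ?u (fst (\<rho> i)) (list_encode (map set_encode Fr)), snd (\<rho> i))"
      unfolding tl .
    have "t0 \<le> i" "list_encode (map set_encode Fr) \<le> n" "set Fr \<subseteq> set Fs"
      using Cons.prems i tlc_le[of ?l] unfolding tl by auto
    from Cons.IH[OF this] obtain t' where "i \<le> t'"
      "?R (loop_state ?b ?u (fst (\<rho> i)) (list_encode (map set_encode Fr)), snd (\<rho> i))
        (loop_state ?b ?u (fst (\<rho> t')) 0, snd (\<rho> t'))" by blast
    with 1 i(1) show ?case by (meson less_imp_le order_trans rtranclp_trans)
  qed
  have "hdc (tlc n) \<le> n" using hdc_le tlc_le order_trans by blast
  \<comment> \<open>The transition at time \<open>t0\<close> enters the loop, so the list is worked
    off from \<open>Suc t0\<close>.\<close>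
  with consume[of "Suc t0" Fs] L obtain t where t: "Suc t0 \<le> t"
    "?R (loop_state ?b ?u (fst (\<rho> (Suc t0))) (hdc (tlc n)), snd (\<rho> (Suc t0)))
        (loop_state ?b ?u (fst (\<rho> t)) 0, snd (\<rho> t))" by auto
  obtain t1 where t1: "t \<le> t1" "fst (\<rho> t1) = ?u"
    "snd (\<rho> t1) = snd (\<rho> t0) \<or> b \<and> snd (\<rho> t0) < snd (\<rho> t1)" using recur by blast
  have "?R (pair 0 v0, c0) (pair 0 ?u, snd (\<rho> t0))" by (rule stem)
  also have "rep_step n \<mu> (pair 0 ?u, snd (\<rho> t0)) (loop_state ?b ?u (fst (\<rho> (Suc t0))) (hdc (tlc n)), snd (\<rho> (Suc t0)))"
    by (rule rep_step_enter[OF n n b2 st _ above]) (simp_all add: \<mu>_def)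
  also note t(2)
  also have "?R (loop_state ?b ?u (fst (\<rho> t)) 0, snd (\<rho> t)) (loop_state ?b ?u ?u 0, snd (\<rho> t1))"
    using forward[of t t1 0] t t1 by simp
  also have "rep_step n \<mu> (loop_state ?b ?u ?u 0, snd (\<rho> t1)) (pair 3 0, snd (\<rho> t1))"
    by (rule rep_step_leave[OF n b2]) (use t1 in \<open>auto simp: \<mu>_def\<close>)
  also have "?R (pair 3 0, snd (\<rho> t1)) (pair 3 0, 0)" by (rule rep_step_empty)
  finally show ?thesis unfolding \<mu>_def by blast
qed

text \<open>If \<open>c\<close> exceeds the values of all codes of the automaton, then so does
  \<open>c + d\<close>, and the equalities tested by \<open>coded_step\<close> fail for
  both.\<close>

lemma lasso_reach_step_imp_inf_run:
  assumes "lasso (reach_step n \<nu>) (above_tests n \<nu>) \<F> p"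
  shows "inf_run (reach_step n \<nu>) \<F> p"
proof (rule lasso_imp_inf_run[OF _ assms])
  fix s c s' c' d
  assume st: "reach_step n \<nu> (s, c) (s', c')" and "above_tests n \<nu> c"
  then have above: "\<nu> t < c" if "t < hdc n" for t
    using that hdc_le[of n] by (simp add: above_tests_def)
  from st have "coded_step (hdc n) \<nu> s c s' c'" by (simp add: reach_step_def)
  then have "coded_step (hdc n) \<nu> s (c + d) s' (c' + d)"
    by (rule coded_step_inv) (use above in fastforce)+
  then show "reach_step n \<nu> (s, c + d) (s', c' + d)" by (simp add: reach_step_def)
qed

section \<open>Deciding repeated reachability\<close>

lemma rep_reachable_iff_inf_run:
  assumes "wf_oca C" "\<And>a. \<nu> (2 * a) = a" "\<And>x. Suc (2 * x) < oca_code C \<Longrightarrow> \<nu> (Suc (2 * x)) = \<mu> x"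
    and n: "hdc n = oca_code C"
  shows "rep_reachable (subst_oca \<mu> C) Fs p \<longleftrightarrow>
    0 \<le> snd p \<and> inf_run (reach_step n \<nu>) (set Fs) (fst p, nat (snd p))"
proof -
  note iff = coded_step_eq_iff[where \<nu> = \<nu> and \<mu> = \<mu>, OF assms(1-3)]
  have step: "reach_step n \<nu> (s, c) (s', c') \<longleftrightarrow> valid_transition (subst_oca \<mu> C) (s, int c) (s', int c')" for s c s' c'
    by (simp add: reach_step_def n iff)
  have configs: "configs (subst_oca \<mu> C) = configs C" by (simp add: configs_def subst_oca_def)
  show ?thesis
  proof
    assume "rep_reachable (subst_oca \<mu> C) Fs p"
    then obtain \<rho> where \<rho>: "valid_inf_computation (subst_oca \<mu> C) \<rho>" "\<rho> 0 = p"
      "\<forall>F\<in>set Fs. \<exists>v\<in>F. \<exists>\<^sub>\<infinity>i. fst (\<rho> i) = v"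
      unfolding rep_reachable_def by (elim exE conjE)
    then have t: "valid_transition (subst_oca \<mu> C) (\<rho> i) (\<rho> (Suc i))" for i
      by (simp add: valid_inf_computation_def)
    then have nonneg: "0 \<le> snd (\<rho> i)" for i unfolding valid_transition_def by blast
    let ?\<rho> = "\<lambda>i. (fst (\<rho> i), nat (snd (\<rho> i)))"
    have "reach_step n \<nu> (?\<rho> i) (?\<rho> (Suc i))" for i
      unfolding step using t nonneg by simp
    then have "inf_run (reach_step n \<nu>) (set Fs) (fst p, nat (snd p))"
      unfolding inf_run_def using \<rho>(2,3) by (intro exI[of _ ?\<rho>]) simp
    with nonneg[of 0] \<rho>(2) show "0 \<le> snd p \<and> inf_run (reach_step n \<nu>) (set Fs) (fst p, nat (snd p))"
      by simp
  next
    assume *: "0 \<le> snd p \<and> inf_run (reach_step n \<nu>) (set Fs) (fst p, nat (snd p))"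
    then have "inf_run (reach_step n \<nu>) (set Fs) (fst p, nat (snd p))" ..
    then obtain \<rho> where \<rho>: "\<rho> 0 = (fst p, nat (snd p))" "\<forall>i. reach_step n \<nu> (\<rho> i) (\<rho> (Suc i))"
      "\<forall>F\<in>set Fs. \<exists>v\<in>F. \<exists>\<^sub>\<infinity>i. fst (\<rho> i) = v"
      unfolding inf_run_def by (elim exE conjE)
    let ?\<rho> = "\<lambda>i. (fst (\<rho> i), int (snd (\<rho> i)))"
    have t: "valid_transition (subst_oca \<mu> C) (?\<rho> i) (?\<rho> (Suc i))" for i
      unfolding step[symmetric] using \<rho>(2) by simp
    have "valid_inf_computation (subst_oca \<mu> C) ?\<rho>"
      unfolding valid_inf_computation_def configs
      using t valid_transition_configs(1)[OF assms(1) t] by (intro conjI image_subsetI allI)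
    moreover have "?\<rho> 0 = p" using \<rho>(1) * by simp
    ultimately show "rep_reachable (subst_oca \<mu> C) Fs p"
      unfolding rep_reachable_def using \<rho>(3) by (intro exI[of _ ?\<rho>]) simp
  qed
qed

theorem decidable_rep_reach_problem:
  "decidable_problem rep_reach_instances rep_reach_code rep_reach_problem"
proof -
  let ?p = "\<lambda>n. hdc (tlc (tlc n))"
  define P where "P n \<longleftrightarrow> even (psnd (?p n)) \<and>
    (\<exists>\<nu>. (\<forall>i. \<nu> (2 * i) = i) \<and> (rep_step n \<nu>)\<^sup>*\<^sup>* (pair 0 (pfst (?p n)), psnd (?p n) div 2) (pair 3 0, 0))" for n
  have "dec P"
    unfolding P_def
    by (intro dec_conj dec_parameterised_reachability[OF counter_system_rep_step dec_rep_step] comp_intros)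
  then obtain f where f: "\<And>n. computes f [n] (of_bool (P n))"
    unfolding dec_def computable_def by blast
  have "P (rep_reach_code i) \<longleftrightarrow> rep_reach_problem i" if "i \<in> rep_reach_instances" for i
  proof -
    obtain C Fs p where i: "i = (C, Fs, p)" by (metis prod_cases3)
    let ?n = "rep_reach_code i"
    have n: "hdc ?n = oca_code C" "hdc (tlc ?n) = list_encode (map set_encode Fs)" "?p ?n = config_code p"
      by (simp_all add: i rep_reach_code_def del: list_encode.simps)
    have wf: "wf_oca C" and "\<And>F. F \<in> set Fs \<Longrightarrow> F \<subseteq> states C"
      using that by (auto simp: i rep_reach_instances_def)
    then have fin: "\<And>F. F \<in> set Fs \<Longrightarrow> finite F"
      by (meson finite_subset wf_oca_def)
    \<comment> \<open>\<open>odd_iff\<close> reads a valuation of the parameters off the odd codes,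
      and \<open>ext_iff\<close> starts from such a valuation; each serves one direction.\<close>
    have odd_iff: "rep_reachable (subst_oca (\<lambda>x. \<nu> (Suc (2 * x))) C) Fs p \<longleftrightarrow>
      0 \<le> snd p \<and> inf_run (reach_step ?n \<nu>) (set Fs) (fst p, nat (snd p))" if "\<And>i. \<nu> (2 * i) = i" for \<nu>
      using rep_reachable_iff_inf_run[OF wf _ _ n(1), of \<nu> "\<lambda>x. \<nu> (Suc (2 * x))"] that by simp
    have ext_iff: "rep_reachable (subst_oca \<mu> C) Fs p \<longleftrightarrow>
      0 \<le> snd p \<and> inf_run (reach_step ?n (ext_val \<mu>)) (set Fs) (fst p, nat (snd p))" for \<mu>
      using rep_reachable_iff_inf_run[OF wf _ _ n(1), of "ext_val \<mu>" \<mu>] by (simp add: ext_val_def)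
    show ?thesis
    proof
      assume P: "P ?n"
      then have p: "0 \<le> snd p" by (simp add: P_def n even_psnd_config_code)
      with P obtain \<nu> where \<nu>: "\<And>i. \<nu> (2 * i) = i"
        "(rep_step ?n \<nu>)\<^sup>*\<^sup>* (pair 0 (fst p), nat (snd p)) (pair 3 0, 0)"
        by (auto simp: P_def n config_code_decode)
      \<comment> \<open>The guessed lasso is unrolled into an infinite run under the same
        valuation.\<close>
      have "inf_run (reach_step ?n \<nu>) (set Fs) (fst p, nat (snd p))"
        using rep_step_imp_lasso[OF n(2) fin \<nu>(2)] by (rule lasso_reach_step_imp_inf_run)
      with p odd_iff[OF \<nu>(1)] show "rep_reach_problem i" by (auto simp: i rep_reach_problem_def)
    next
      assume "rep_reach_problem i"
      then obtain \<mu> where "rep_reachable (subst_oca \<mu> C) Fs p" by (auto simp: i rep_reach_problem_def)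
      with ext_iff have p: "0 \<le> snd p"
        and run: "inf_run (reach_step ?n (ext_val \<mu>)) (set Fs) (fst p, nat (snd p))" by auto
      from inf_run_imp_rep_step[OF n(2) fin run] obtain y where
        "(rep_step ?n ((ext_val \<mu>)(anchor ?n := y)))\<^sup>*\<^sup>* (pair 0 (fst p), nat (snd p)) (pair 3 0, 0)" by blast
      \<comment> \<open>The code \<open>anchor ?n\<close> is odd, so the update leaves the constants
        unchanged.\<close>
      moreover have "((ext_val \<mu>)(anchor ?n := y)) (2 * i) = i" for i
        by (auto simp: ext_val_def) presburger
      ultimately show "P ?n"
        unfolding P_def n config_code_decode(1,3)[OF p]
        by (intro conjI config_code_decode(2)[OF p] exI[of _ "(ext_val \<mu>)(anchor ?n := y)"] allI)
    qed
  qed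
  with f have "computes f [rep_reach_code i] (if rep_reach_problem i then 1 else 0)"
    if "i \<in> rep_reach_instances" for i
    using that by (metis of_bool_def)
  then show ?thesis unfolding decidable_problem_def by blast
qed

theorem mainTheorem1:
  shows "decidable_problem reach_instances reach_code reach_problem \<and>
         decidable_problem rep_reach_instances rep_reach_code rep_reach_problem"
  using decidable_reach_problem decidable_rep_reach_problem by (rule conjI)

end
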